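(* For every family $\mathcal G$ of graphs, the problems $\mathcal L$DF and $\mathcal L$PF restricted to graphs in $\mathcal G$ have the same computational complexity (one is polynomial-time solvable, resp. NP-hard, on $\mathcal G$ if and only if the other is). The same holds for the pair $\ell$-$\mathcal L$DF and $\ell$-$\mathcal L$PF, and for the pair Free $\ell$-$\mathcal L$DF and Free $\ell$-$\mathcal L$PF.
   Context: Graphs are finite, simple, undirected; $N[v]$ is the closed neighborhood; $f(U)=\sum_{x\in U}f(x)$; $[0,\ell]=\{0,\dots,\ell\}$; $F$ is a symbol meaning "free". Given a graph $G=(V,E)$, $\ell\in\mathbb{Z}_+$, $\mathbf k\in\mathbb{Z}_+^V$ and $\mathbf t\in\{0,F\}^V$: a labelled dominating function is $f:V\to[0,\ell]$ with $f(N[v])\geq k(v)$ for all $v$ and $f(v)=0$ whenever $t(v)=0$; a labelled packing function is $f:V\to[0,\ell]$ with $f(N[v])\leq k(v)$ for all $v$ and $f(v)=0$ whenever $t(v)=0$. $\mathcal L$DF: given $(G,\ell,\mathbf k,\mathbf t)$, compute the minimum of $f(V)$ over labelled dominating functions. $\mathcal L$PF: given $(G,\ell,\mathbf k,\mathbf t)$, compute the maximum of $f(V)$ over labelled packing functions. For a fixed $\ell$, $\ell$-$\mathcal L$DF and $\ell$-$\mathcal L$PF are these problems restricted to instances with that value of $\ell$; Free $\ell$-$\mathcal L$DF and Free $\ell$-$\mathcal L$PF are the further restrictions to instances with $t(v)=F$ for all $v\in V$. *)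

theory Defs
  imports "HOL-Library.FuncSet" "HOL-Computational_Algebra.Polynomial"
begin

section \<open>Polynomial time and NP\<close>

text \<open>
  The model of computation is a structured program over finitely many registers, each holding a
  stack of bits. A step pushes, pops or inspects a single bit and costs one time unit. A stack is
  half of a Turing machine tape, so these programs and deterministic multi-tape Turing machines
  simulate each other with constant-factor overhead (up to recoding the tape alphabet in bits).
\<close>

type_synonym regs = "nat \<Rightarrow> bool list"

datatype prog =
    Skip
  | Push nat bool
  | Pop nat
  | Seq prog prog
  | Switch nat prog prog prog  \<comment> \<open>branches: register empty, top bit 0, top bit 1\<close>
  | While nat prog  \<comment> \<open>loop as long as the register is nonempty\<close>

inductive exec :: "prog \<Rightarrow> regs \<Rightarrow> nat \<Rightarrow> regs \<Rightarrow> bool" where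
  exec_Skip: "exec Skip s 1 s"
| exec_Push: "exec (Push r b) s 1 (s(r := b # s r))"
| exec_Pop: "exec (Pop r) s 1 (s(r := tl (s r)))"
| exec_Seq: "exec c s m s' \<Longrightarrow> exec d s' n s'' \<Longrightarrow> exec (Seq c d) s (m + n) s''"
| exec_Switch_empty: "s r = [] \<Longrightarrow> exec c s n s' \<Longrightarrow> exec (Switch r c d e) s (Suc n) s'"
| exec_Switch_0: "s r = False # bs \<Longrightarrow> exec d s n s' \<Longrightarrow> exec (Switch r c d e) s (Suc n) s'"
| exec_Switch_1: "s r = True # bs \<Longrightarrow> exec e s n s' \<Longrightarrow> exec (Switch r c d e) s (Suc n) s'"
| exec_While_stop: "s r = [] \<Longrightarrow> exec (While r c) s 1 s"
| exec_While_step: "s r \<noteq> [] \<Longrightarrow> exec c s m s' \<Longrightarrow> exec (While r c) s' n s''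
    \<Longrightarrow> exec (While r c) s (Suc (m + n)) s''"

definition init_regs :: "bool list list \<Rightarrow> regs" where
  "init_regs xs r = (if r < length xs then xs ! r else [])"

text \<open>
  The inputs are the initial contents of the first registers, the output is the final content of
  register 0. Only the behaviour on the inputs in \<open>D\<close> is constrained.
\<close>

definition polytime_on :: "bool list list set \<Rightarrow> (bool list list \<Rightarrow> bool list) \<Rightarrow> bool" where
  "polytime_on D f \<longleftrightarrow> (\<exists>c (p :: nat poly). \<forall>xs\<in>D. \<exists>n s.
     exec c (init_regs xs) n s \<and> s 0 = f xs \<and> n \<le> poly p (sum_list (map length xs)))"

definition in_NP :: "bool list set \<Rightarrow> bool" where
  "in_NP L \<longleftrightarrow> (\<exists>V (q :: nat poly). polytime_on {[x, w] | x w. True} V \<and>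
     (\<forall>x. x \<in> L \<longleftrightarrow> (\<exists>w. length w \<le> poly q (length x) \<and> V [x, w] = [True])))"

text \<open>
  Polynomial-time many-one reducibility to the promise problem with yes-instances \<open>Y\<close> and
  no-instances \<open>N\<close>.
\<close>

definition many_one_reducible :: "bool list set \<Rightarrow> bool list set \<Rightarrow> bool list set \<Rightarrow> bool" where
  "many_one_reducible L Y N \<longleftrightarrow> (\<exists>f. polytime_on {[x] | x. True} f \<and>
     (\<forall>x. (x \<in> L \<longrightarrow> f [x] \<in> Y) \<and> (x \<notin> L \<longrightarrow> f [x] \<in> N)))"

section \<open>Optimization problems\<close>

fun binary :: "nat \<Rightarrow> bool list" where  \<comment> \<open>least significant bit first\<close>
  "binary n = (if n = 0 then [] else odd n # binary (n div 2))"

declare binary.simps [simp del]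

definition delimited :: "bool list \<Rightarrow> bool list" where  \<comment> \<open>a prefix code for bit strings\<close>
  "delimited bs = concat (map (\<lambda>b. [True, b]) bs) @ [False]"

datatype goal = Minimize | Maximize

text \<open>
  The set \<open>codes P i\<close> consists of all strings that represent the instance \<open>i\<close>; \<open>objective P i\<close> is
  the set of objective values attained by the feasible solutions of \<open>i\<close>.
\<close>

record 'i problem =
  instances :: "'i set"
  codes :: "'i \<Rightarrow> bool list set"
  objective :: "'i \<Rightarrow> nat set"
  goal :: goal

definition restrict_instances :: "'i problem \<Rightarrow> ('i \<Rightarrow> bool) \<Rightarrow> 'i problem" where
  "restrict_instances P Q = P\<lparr>instances := {i \<in> instances P. Q i}\<rparr>"

definition opt :: "'i problem \<Rightarrow> 'i \<Rightarrow> nat option" where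
  "opt P i = (if objective P i = {} then None
     else Some (case goal P of Minimize \<Rightarrow> Min (objective P i) | Maximize \<Rightarrow> Max (objective P i)))"

fun answer :: "nat option \<Rightarrow> bool list" where
  "answer None = []"
| "answer (Some m) = True # binary m"

definition polytime_solvable :: "'i problem \<Rightarrow> bool" where
  "polytime_solvable P \<longleftrightarrow> (\<exists>f. polytime_on {[w] | w i. i \<in> instances P \<and> w \<in> codes P i} f \<and>
     (\<forall>i \<in> instances P. \<forall>w \<in> codes P i. f [w] = answer (opt P i)))"

text \<open>
  NP-hardness of an optimization problem is NP-hardness of its decision version: given an instance
  and a threshold, is there a feasible solution whose value is at least as good as the threshold?
  Thresholds are arbitrary integers, so that a problem whose only instance is the empty graph has
  both yes- and no-instances, for either goal.
\<close>

definition reaches :: "'i problem \<Rightarrow> 'i \<Rightarrow> int \<Rightarrow> bool" where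
  "reaches P i B \<longleftrightarrow> (\<exists>m \<in> objective P i.
     case goal P of Minimize \<Rightarrow> int m \<le> B | Maximize \<Rightarrow> int m \<ge> B)"

definition decision_code :: "int \<Rightarrow> bool list \<Rightarrow> bool list" where
  "decision_code B w = (B < 0) # delimited (binary (nat \<bar>B\<bar>)) @ w"

definition NP_hard :: "'i problem \<Rightarrow> bool" where
  "NP_hard P \<longleftrightarrow> (\<forall>L. in_NP L \<longrightarrow> many_one_reducible L
     {decision_code B w | B w i. i \<in> instances P \<and> w \<in> codes P i \<and> reaches P i B}
     {decision_code B w | B w i. i \<in> instances P \<and> w \<in> codes P i \<and> \<not> reaches P i B})"

section \<open>Labelled domination and packing\<close>

type_synonym 'a graph = "'a set \<times> 'a set set"

abbreviation verts :: "'a graph \<Rightarrow> 'a set" where "verts G \<equiv> fst G"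
abbreviation edges :: "'a graph \<Rightarrow> 'a set set" where "edges G \<equiv> snd G"

definition simple_graph :: "'a graph \<Rightarrow> bool" where
  "simple_graph G \<longleftrightarrow> finite (verts G) \<and> (\<forall>e \<in> edges G. e \<subseteq> verts G \<and> card e = 2)"

definition closed_nbhd :: "'a graph \<Rightarrow> 'a \<Rightarrow> 'a set" where
  "closed_nbhd G v = insert v {u \<in> verts G. {u, v} \<in> edges G}"

datatype label = Zero | Free

text \<open>Only the values of \<open>demand\<close> and \<open>label\<close> on the vertices of the graph matter.\<close>

record 'a instnc =
  graph :: "'a graph"
  bound :: nat
  demand :: "'a \<Rightarrow> nat"
  label :: "'a \<Rightarrow> label"

definition labelled_function :: "'a instnc \<Rightarrow> ('a \<Rightarrow> nat) \<Rightarrow> bool" where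
  "labelled_function I f \<longleftrightarrow> f \<in> verts (graph I) \<rightarrow>\<^sub>E {0..bound I} \<and>
     (\<forall>v \<in> verts (graph I). label I v = Zero \<longrightarrow> f v = 0)"

definition dominating_function :: "'a instnc \<Rightarrow> ('a \<Rightarrow> nat) \<Rightarrow> bool" where
  "dominating_function I f \<longleftrightarrow> labelled_function I f \<and>
     (\<forall>v \<in> verts (graph I). sum f (closed_nbhd (graph I) v) \<ge> demand I v)"

definition packing_function :: "'a instnc \<Rightarrow> ('a \<Rightarrow> nat) \<Rightarrow> bool" where
  "packing_function I f \<longleftrightarrow> labelled_function I f \<and>
     (\<forall>v \<in> verts (graph I). sum f (closed_nbhd (graph I) v) \<le> demand I v)"

text \<open>
  An instance is written down relative to an enumeration \<open>vs\<close> of its vertices: the bound, then for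
  each vertex its label, its demand and its row of the adjacency matrix. Numbers are in binary.
  Every enumeration yields a valid code.
\<close>

definition vertex_code :: "'a instnc \<Rightarrow> 'a list \<Rightarrow> 'a \<Rightarrow> bool list" where
  "vertex_code I vs v = (label I v = Free) # delimited (binary (demand I v))
     @ delimited (map (\<lambda>u. {u, v} \<in> edges (graph I)) vs)"

definition instnc_code :: "'a instnc \<Rightarrow> 'a list \<Rightarrow> bool list" where
  "instnc_code I vs = delimited (binary (bound I))
     @ concat (map (\<lambda>v. True # vertex_code I vs v) vs) @ [False]"

definition instnc_codes :: "'a instnc \<Rightarrow> bool list set" where
  "instnc_codes I = {instnc_code I vs | vs. distinct vs \<and> set vs = verts (graph I)}"

definition LDF :: "'a graph set \<Rightarrow> 'a instnc problem" where
  "LDF \<G> = \<lparr>instances = {I. graph I \<in> \<G>}, codes = instnc_codes,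
     objective = (\<lambda>I. {sum f (verts (graph I)) | f. dominating_function I f}),
     goal = Minimize\<rparr>"

definition LPF :: "'a graph set \<Rightarrow> 'a instnc problem" where
  "LPF \<G> = \<lparr>instances = {I. graph I \<in> \<G>}, codes = instnc_codes,
     objective = (\<lambda>I. {sum f (verts (graph I)) | f. packing_function I f}),
     goal = Maximize\<rparr>"

definition ell_LDF :: "nat \<Rightarrow> 'a graph set \<Rightarrow> 'a instnc problem" where
  "ell_LDF l \<G> = restrict_instances (LDF \<G>) (\<lambda>I. bound I = l)"

definition ell_LPF :: "nat \<Rightarrow> 'a graph set \<Rightarrow> 'a instnc problem" where
  "ell_LPF l \<G> = restrict_instances (LPF \<G>) (\<lambda>I. bound I = l)"

definition all_free :: "'a instnc \<Rightarrow> bool" where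
  "all_free I \<longleftrightarrow> (\<forall>v \<in> verts (graph I). label I v = Free)"

definition free_ell_LDF :: "nat \<Rightarrow> 'a graph set \<Rightarrow> 'a instnc problem" where
  "free_ell_LDF l \<G> = restrict_instances (ell_LDF l \<G>) all_free"

definition free_ell_LPF :: "nat \<Rightarrow> 'a graph set \<Rightarrow> 'a instnc problem" where
  "free_ell_LPF l \<G> = restrict_instances (ell_LPF l \<G>) all_free"

end

theory Submission
  imports Defs
begin

text \<open>
  Replacing \<open>f v\<close> by \<open>\<ell> - f v\<close> on the free vertices exchanges dominating and packing functions if each
  demand \<open>k v\<close> is replaced by \<open>\<ell> c v - k v\<close>, where \<open>c v\<close> is the number of free vertices in the closed
  neighbourhood of \<open>v\<close>; the objective value \<open>m\<close> becomes \<open>L - m\<close>, where \<open>L\<close> is \<open>\<ell>\<close> times the number of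
  free vertices. Graph, bound and labels do not change. Demands with \<open>k v > \<ell> c v\<close> are vacuous for
  packings, so that truncated subtraction is right, and make domination infeasible. The new
  instance is computed in polynomial time by a program that adds \<open>\<ell>\<close> once for every free vertex met
  in a row of the adjacency matrix.
\<close>

section \<open>Timed executions\<close>

text \<open>The combinatorial core is short; the obstacle is that polynomial time refers to one
  concrete machine model, so the reduction must exist as a verified program with a time bound. The
  input string itself serves as a clock: every number that occurs is below 2 to the power of its
  length, so all arithmetic has one fixed width and no word size is ever computed. The solver of the
  other problem is an arbitrary program, known only by its input, output and time; it is relocated
  to fresh registers so that intermediate results survive its run. A string may encode several
  instances (isomorphic graphs, demands that differ off the graph). Execution is deterministic, so
  correctness for each pair of instance and code already makes the answer a function of the string,
  and nothing has to be proved about decoding. The two directions differ only in feasibility: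
  packing always admits the zero function, domination need not, whence the flag
  \<open>strict\<close> and a register that remembers violated demands.\<close>

definition runs :: "prog \<Rightarrow> regs \<Rightarrow> nat \<Rightarrow> regs \<Rightarrow> bool" where
  "runs c s t s' \<longleftrightarrow> (\<exists>n\<le>t. exec c s n s')"

text \<open>Padding the time lets branches of different cost share one bound. The equation
  \<open>s' = s''\<close> is a premise so that a final state may be given in whichever form of
  function updates suits the next step.\<close>

lemma runs_mono: "runs c s t s' \<Longrightarrow> t \<le> t' \<Longrightarrow> s' = s'' \<Longrightarrow> runs c s t' s''"
  unfolding runs_def by (meson order_trans)

lemma runs_Skip: "runs Skip s 1 s"
  and runs_Push: "runs (Push r b) s 1 (s(r := b # s r))"
  and runs_Pop: "runs (Pop r) s 1 (s(r := tl (s r)))"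
  unfolding runs_def by (blast intro: exec.intros)+

lemma runs_Seq: "runs c s m s' \<Longrightarrow> runs d s' n s'' \<Longrightarrow> runs (Seq c d) s (m + n) s''"
  unfolding runs_def by (meson exec_Seq add_mono)

lemma runs_Switch:
  assumes "case s r of [] \<Rightarrow> runs c s t s' | b # _ \<Rightarrow> runs (if b then e else d) s t s'"
  shows "runs (Switch r c d e) s (Suc t) s'"
proof (cases "s r")
  case Nil
  then obtain n where "n \<le> t" "exec c s n s'"
    using assms by (auto simp: runs_def)
  then show ?thesis
    unfolding runs_def using exec_Switch_empty[of s r c n s' d e] Nil by auto
next
  case (Cons b bs)
  then obtain n where "n \<le> t" "exec (if b then e else d) s n s'"
    using assms by (auto simp: runs_def)
  then have "exec (Switch r c d e) s (Suc n) s'"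
    using Cons exec_Switch_0 exec_Switch_1 by (cases b) auto
  then show ?thesis
    using \<open>n \<le> t\<close> unfolding runs_def by auto
qed

lemma runs_While_stop: "s r = [] \<Longrightarrow> runs (While r c) s 1 s"
  unfolding runs_def by (blast intro: exec.intros)

lemma runs_While_step:
  assumes "s r \<noteq> []" "runs c s m s'" "runs (While r c) s' n s''"
  shows "runs (While r c) s (Suc (m + n)) s''"
proof -
  obtain m' n' where "m' \<le> m" "n' \<le> n" "exec c s m' s'" "exec (While r c) s' n' s''"
    using assms by (auto simp: runs_def)
  then show ?thesis
    using assms(1) unfolding runs_def
    by (intro exI[of _ "Suc (m' + n')"]) (auto intro: exec_While_step)
qed

inductive_cases exec_SkipE: "exec Skip s n s'"
inductive_cases exec_PushE: "exec (Push r b) s n s'"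
inductive_cases exec_PopE: "exec (Pop r) s n s'"
inductive_cases exec_SeqE: "exec (Seq c d) s n s'"
inductive_cases exec_SwitchE: "exec (Switch r c d e) s n s'"
inductive_cases exec_WhileE: "exec (While r c) s n s'"

text \<open>Makes the final state a function of program and start state, so that the description in
  \<open>result\<close> denotes it.\<close>

lemma exec_deterministic:
  "exec c s n s' \<Longrightarrow> exec c s n' s'' \<Longrightarrow> s'' = s'"
proof (induction arbitrary: n' s'' rule: exec.induct)
  case exec_Skip then show ?case by (auto elim: exec_SkipE)
next
  case exec_Push then show ?case by (auto elim: exec_PushE)
next
  case exec_Pop then show ?case by (auto elim: exec_PopE)
next
  case (exec_Seq c s m s1 d n s2)
  from exec_Seq.prems obtain k k' u where "exec c s k u" "exec d u k' s''"
    by (rule exec_SeqE)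
  then show ?case
    using exec_Seq.IH by blast
next
  case (exec_Switch_empty s r c m s1 d e)
  from exec_Switch_empty.prems obtain k where "exec c s k s''"
    by (rule exec_SwitchE) (use exec_Switch_empty.hyps in simp_all)
  then show ?case
    by (rule exec_Switch_empty.IH)
next
  case (exec_Switch_0 s r bs d m s1 c e)
  from exec_Switch_0.prems obtain k where "exec d s k s''"
    by (rule exec_SwitchE) (use exec_Switch_0.hyps in simp_all)
  then show ?case
    by (rule exec_Switch_0.IH)
next
  case (exec_Switch_1 s r bs e m s1 c d)
  from exec_Switch_1.prems obtain k where "exec e s k s''"
    by (rule exec_SwitchE) (use exec_Switch_1.hyps in simp_all)
  then show ?case
    by (rule exec_Switch_1.IH)
next
  case (exec_While_stop s r c)
  from exec_While_stop.prems show ?case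
    by (rule exec_WhileE) (use exec_While_stop.hyps in simp_all)
next
  case (exec_While_step s r c m s1 n s2)
  from exec_While_step.prems obtain k k' u
    where "exec c s k u" "exec (While r c) u k' s''"
    by (rule exec_WhileE) (use \<open>s r \<noteq> []\<close> in blast)+
  then show ?case
    using exec_While_step.IH by blast
qed

text \<open>A step lengthens a register by at most one bit, so running time bounds output size. This
  is what keeps the composition of two polynomial-time programs polynomial.\<close>

lemma exec_length: "exec c s n s' \<Longrightarrow> length (s' r) \<le> length (s r) + n"
  by (induction rule: exec.induct) auto

section \<open>Renaming of registers\<close>

fun rename_regs :: "(nat \<Rightarrow> nat) \<Rightarrow> prog \<Rightarrow> prog" where
  "rename_regs h Skip = Skip"
| "rename_regs h (Push r b) = Push (h r) b"
| "rename_regs h (Pop r) = Pop (h r)"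
| "rename_regs h (Seq c d) = Seq (rename_regs h c) (rename_regs h d)"
| "rename_regs h (Switch r c d e) =
     Switch (h r) (rename_regs h c) (rename_regs h d) (rename_regs h e)"
| "rename_regs h (While r c) = While (h r) (rename_regs h c)"

text \<open>Seen through \<open>h\<close>, the renamed program performs the same steps in the same
  time, and the registers outside the range of \<open>h\<close> are private to the caller.
  Injectivity keeps updates of distinct registers distinct.\<close>

lemma exec_rename_regs:
  assumes "exec c s n s'" "inj h" "t \<circ> h = s"
  shows "\<exists>t'. exec (rename_regs h c) t n t' \<and> t' \<circ> h = s' \<and> (\<forall>r. r \<notin> range h \<longrightarrow> t' r = t r)"
  using assms(1,3)
proof (induction arbitrary: t rule: exec.induct)
  case (exec_Skip s)
  then show ?case by (metis exec.exec_Skip rename_regs.simps(1))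
next
  case (exec_Push r b s)
  let ?t = "t(h r := b # t (h r))"
  have "exec (Push (h r) b) t 1 ?t"
    by (rule exec.intros)
  moreover have "?t \<circ> h = s(r := b # s r)"
    using exec_Push \<open>inj h\<close> by (auto simp: fun_eq_iff inj_eq)
  moreover have "\<forall>q. q \<notin> range h \<longrightarrow> ?t q = t q"
    by auto
  ultimately show ?case
    unfolding rename_regs.simps by blast
next
  case (exec_Pop r s)
  let ?t = "t(h r := tl (t (h r)))"
  have "exec (Pop (h r)) t 1 ?t"
    by (rule exec.intros)
  moreover have "?t \<circ> h = s(r := tl (s r))"
    using exec_Pop \<open>inj h\<close> by (auto simp: fun_eq_iff inj_eq)
  moreover have "\<forall>q. q \<notin> range h \<longrightarrow> ?t q = t q"
    by auto
  ultimately show ?case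
    unfolding rename_regs.simps by blast
next
  case (exec_Seq c s m s' d n s'')
  obtain t' where t': "exec (rename_regs h c) t m t'" "t' \<circ> h = s'"
    "\<forall>r. r \<notin> range h \<longrightarrow> t' r = t r"
    using exec_Seq.IH(1)[OF exec_Seq.prems] by blast
  obtain t'' where t'': "exec (rename_regs h d) t' n t''" "t'' \<circ> h = s''"
    "\<forall>r. r \<notin> range h \<longrightarrow> t'' r = t' r"
    using exec_Seq.IH(2)[OF t'(2)] by blast
  have "exec (rename_regs h (Seq c d)) t (m + n) t''"
    using t'(1) t''(1) by (auto intro: exec.exec_Seq)
  then show ?case
    using t' t'' by auto
next
  case (exec_Switch_empty s r c n s' d e)
  obtain t' where t': "exec (rename_regs h c) t n t'" "t' \<circ> h = s'"
    "\<forall>r. r \<notin> range h \<longrightarrow> t' r = t r"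
    using exec_Switch_empty.IH[OF exec_Switch_empty.prems] by blast
  have "t (h r) = []"
    using exec_Switch_empty by auto
  then have "exec (rename_regs h (Switch r c d e)) t (Suc n) t'"
    unfolding rename_regs.simps using t'(1) by (rule exec.intros)
  then show ?case
    using t' by blast
next
  case (exec_Switch_0 s r bs d n s' c e)
  obtain t' where t': "exec (rename_regs h d) t n t'" "t' \<circ> h = s'"
    "\<forall>r. r \<notin> range h \<longrightarrow> t' r = t r"
    using exec_Switch_0.IH[OF exec_Switch_0.prems] by blast
  have "t (h r) = False # bs"
    using exec_Switch_0 by auto
  then have "exec (rename_regs h (Switch r c d e)) t (Suc n) t'"
    unfolding rename_regs.simps using t'(1) by (rule exec.intros)
  then show ?case
    using t' by blast
next
  case (exec_Switch_1 s r bs e n s' c d)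
  obtain t' where t': "exec (rename_regs h e) t n t'" "t' \<circ> h = s'"
    "\<forall>r. r \<notin> range h \<longrightarrow> t' r = t r"
    using exec_Switch_1.IH[OF exec_Switch_1.prems] by blast
  have "t (h r) = True # bs"
    using exec_Switch_1 by auto
  then have "exec (rename_regs h (Switch r c d e)) t (Suc n) t'"
    unfolding rename_regs.simps using t'(1) by (rule exec.intros)
  then show ?case
    using t' by blast
next
  case (exec_While_stop s r c)
  then have "t (h r) = []"
    by auto
  then have "exec (rename_regs h (While r c)) t 1 t"
    unfolding rename_regs.simps by (rule exec.intros)
  then show ?case
    using exec_While_stop by blast
next
  case (exec_While_step s r c m s' n s'')
  obtain t' where t': "exec (rename_regs h c) t m t'" "t' \<circ> h = s'"
    "\<forall>r. r \<notin> range h \<longrightarrow> t' r = t r"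
    using exec_While_step.IH(1)[OF exec_While_step.prems] by blast
  obtain t'' where t'': "exec (rename_regs h (While r c)) t' n t''" "t'' \<circ> h = s''"
    "\<forall>r. r \<notin> range h \<longrightarrow> t'' r = t' r"
    using exec_While_step.IH(2)[OF t'(2)] by blast
  have "t (h r) \<noteq> []"
    using exec_While_step by auto
  then have "exec (rename_regs h (While r c)) t (Suc (m + n)) t''"
    using t'(1) t''(1) by (auto intro: exec.exec_While_step)
  then show ?case
    using t' t'' by auto
qed

section \<open>Derived control structures\<close>

definition top_bit :: "bool list \<Rightarrow> bool" where
  "top_bit bs \<longleftrightarrow> bs \<noteq> [] \<and> hd bs"

lemma top_bit_simps [simp]: "\<not> top_bit []" "top_bit (b # bs) = b"
  by (auto simp: top_bit_def)

text \<open>An empty register reads as bit 0. Arithmetic relies on this default to pad short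
  numbers, and \<open>BAD\<close> relies on it as a flag that is empty when unset.\<close>

definition pop_bit :: "nat \<Rightarrow> (bool \<Rightarrow> prog) \<Rightarrow> prog" where
  "pop_bit r f = Switch r (f False) (Seq (Pop r) (f False)) (Seq (Pop r) (f True))"

lemma runs_pop_bit:
  assumes "runs (f (top_bit (s r))) (s(r := tl (s r))) t s'"
  shows "runs (pop_bit r f) s (t + 2) s'"
proof -
  have "runs (pop_bit r f) s (Suc (1 + t)) s'"
    unfolding pop_bit_def
  proof (rule runs_Switch, cases "s r")
    case Nil
    then have "s(r := tl (s r)) = s"
      by auto
    then show "case s r of [] \<Rightarrow> runs (f False) s (1 + t) s'
      | b # _ \<Rightarrow> runs (if b then Seq (Pop r) (f True) else Seq (Pop r) (f False)) s (1 + t) s'"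
      using assms Nil by (auto intro: runs_mono)
  next
    case (Cons b bs)
    have "runs (Seq (Pop r) (f b)) s (1 + t) s'"
      using assms Cons by (intro runs_Seq[OF runs_Pop]) auto
    then show "case s r of [] \<Rightarrow> runs (f False) s (1 + t) s'
      | b # _ \<Rightarrow> runs (if b then Seq (Pop r) (f True) else Seq (Pop r) (f False)) s (1 + t) s'"
      using Cons by (cases b) auto
  qed
  then show ?thesis
    by (rule runs_mono) auto
qed

definition foreach :: "nat \<Rightarrow> (bool \<Rightarrow> prog) \<Rightarrow> prog" where
  "foreach r f = While r (pop_bit r f)"

text \<open>The invariant is indexed by the consumed prefix: \<open>S ys\<close> gives all registers
  but \<open>r\<close> after the bits \<open>ys\<close>. The extra 3 per bit are two units for
  \<open>pop_bit\<close> and one for the loop test.\<close>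

lemma runs_foreach:
  assumes body: "\<And>ys x zs. xs = ys @ x # zs \<Longrightarrow>
      runs (f x) ((S ys)(r := zs)) T ((S (ys @ [x]))(r := zs))"
    and s: "s = (S [])(r := xs)"
  shows "runs (foreach r f) s (length xs * (T + 3) + 1) ((S xs)(r := []))"
proof -
  have "runs (foreach r f) ((S ys)(r := zs)) (length zs * (T + 3) + 1) ((S xs)(r := []))"
    if "xs = ys @ zs" for ys zs
    using that
  proof (induction zs arbitrary: ys)
    case Nil
    then show ?case
      unfolding foreach_def
      by (intro runs_mono[OF runs_While_stop]) (auto simp: fun_eq_iff)
  next
    case (Cons z zs)
    have "runs (pop_bit r f) ((S ys)(r := z # zs)) (T + 2) ((S (ys @ [z]))(r := zs))"
      using body[OF Cons.prems] by (intro runs_pop_bit) simp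
    moreover have "runs (foreach r f) ((S (ys @ [z]))(r := zs)) (length zs * (T + 3) + 1)
        ((S xs)(r := []))"
      using Cons by (intro Cons.IH) simp
    ultimately have "runs (foreach r f) ((S ys)(r := z # zs))
        (Suc (T + 2 + (length zs * (T + 3) + 1))) ((S xs)(r := []))"
      unfolding foreach_def by (intro runs_While_step) simp_all
    then show ?case
      by (rule runs_mono) auto
  qed
  from this[of "[]" xs] show ?thesis
    using s by simp
qed

text \<open>
  Each item of the list read from register \<open>i\<close> is announced by a bit 1 and the list is closed by a
  bit 0; the register \<open>g\<close> is nonempty while the loop is to be continued.
\<close>

definition items :: "nat \<Rightarrow> nat \<Rightarrow> prog \<Rightarrow> prog" where
  "items i g c = Seq (Push g True) (While g (pop_bit i (\<lambda>b. if b then c else Pop g)))"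

text \<open>Items carry no length information, so the body has to consume exactly
  \<open>enc x\<close> whatever rest \<open>us\<close> follows; this is where self-delimiting codes
  enter. The 6 pays for raising the flag, the round that reads the closing bit, and leaving the
  loop.\<close>

lemma runs_items:
  assumes body: "\<And>ys x zs us. xs = ys @ x # zs \<Longrightarrow>
      runs c ((S ys)(i := enc x @ us, g := [True])) T ((S (ys @ [x]))(i := us, g := [True]))"
    and "i \<noteq> g"
    and s: "s = (S [])(i := concat (map (\<lambda>x. True # enc x) xs) @ False # us, g := [])"
  shows "runs (items i g c) s (length xs * (T + 3) + 6) ((S xs)(i := us, g := []))"
proof -
  let ?w = "While g (pop_bit i (\<lambda>b. if b then c else Pop g))"
  have "runs ?w ((S ys)(i := concat (map (\<lambda>x. True # enc x) zs) @ False # us, g := [True]))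
      (length zs * (T + 3) + 5) ((S xs)(i := us, g := []))"
    if "xs = ys @ zs" for ys zs
    using that
  proof (induction zs arbitrary: ys)
    case Nil
    let ?s = "(S ys)(i := concat (map (\<lambda>x. True # enc x) []) @ False # us, g := [True])"
    have "runs (pop_bit i (\<lambda>b. if b then c else Pop g)) ?s (1 + 2) ((S ys)(i := us, g := []))"
      using \<open>i \<noteq> g\<close> by (intro runs_pop_bit) (auto intro!: runs_mono[OF runs_Pop])
    then have "runs ?w ?s (Suc ((1 + 2) + 1)) ((S ys)(i := us, g := []))"
      by (intro runs_While_step[OF _ _ runs_While_stop]) auto
    then show ?case
      by (rule runs_mono) (use Nil in \<open>auto simp: fun_eq_iff\<close>)
  next
    case (Cons z zs)
    let ?us = "concat (map (\<lambda>x. True # enc x) zs) @ False # us"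
    have "runs (pop_bit i (\<lambda>b. if b then c else Pop g))
        ((S ys)(i := True # enc z @ ?us, g := [True])) (T + 2)
        ((S (ys @ [z]))(i := ?us, g := [True]))"
      using body[OF Cons.prems, of ?us] \<open>i \<noteq> g\<close>
      by (intro runs_pop_bit) (simp add: fun_upd_twist)
    moreover have "runs ?w ((S (ys @ [z]))(i := ?us, g := [True]))
        (length zs * (T + 3) + 5) ((S xs)(i := us, g := []))"
      using Cons by (intro Cons.IH) simp
    ultimately have "runs ?w ((S ys)(i := True # enc z @ ?us, g := [True]))
        (Suc (T + 2 + (length zs * (T + 3) + 5))) ((S xs)(i := us, g := []))"
      by (intro runs_While_step) simp_all
    then show ?case
      unfolding list.map concat.simps append_Cons append_assoc by (rule runs_mono) auto
  qed
  from this[of "[]" xs] have "runs (items i g c) s (1 + (length xs * (T + 3) + 5))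
      ((S xs)(i := us, g := []))"
    unfolding items_def s by (intro runs_Seq[OF runs_Push]) simp
  then show ?thesis
    by (rule runs_mono) simp_all
qed

definition delim :: "nat \<Rightarrow> nat \<Rightarrow> (bool \<Rightarrow> prog) \<Rightarrow> prog" where
  "delim i g f = items i g (pop_bit i f)"

lemma runs_delim:
  assumes body: "\<And>ys x zs us. xs = ys @ x # zs \<Longrightarrow>
      runs (f x) ((S ys)(i := us, g := [True])) T ((S (ys @ [x]))(i := us, g := [True]))"
    and "i \<noteq> g"
    and s: "s = (S [])(i := delimited xs @ us, g := [])"
  shows "runs (delim i g f) s (length xs * (T + 5) + 6) ((S xs)(i := us, g := []))"
proof -
  have "runs (delim i g f) s (length xs * ((T + 2) + 3) + 6) ((S xs)(i := us, g := []))"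
    unfolding delim_def
  \<comment> \<open>In \<open>delimited\<close>, every bit is an item of length one, announced by
    its own 1.\<close>
  proof (rule runs_items[where enc = "\<lambda>x. [x]"])
    fix ys x zs us
    assume "xs = ys @ x # zs"
    from body[OF this] show "runs (pop_bit i f) ((S ys)(i := [x] @ us, g := [True])) (T + 2)
        ((S (ys @ [x]))(i := us, g := [True]))"
      using \<open>i \<noteq> g\<close> by (intro runs_pop_bit) (simp add: fun_upd_twist)
  qed (use assms in \<open>auto simp: delimited_def\<close>)
  then show ?thesis
    by (rule runs_mono) auto
qed

definition move :: "nat \<Rightarrow> nat \<Rightarrow> prog" where
  "move r t = foreach r (Push t)"

lemma runs_move:
  assumes "r \<noteq> t"
  shows "runs (move r t) s (4 * length (s r) + 1) (s(r := [], t := rev (s r) @ s t))"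
proof -
  have "runs (move r t) s (length (s r) * (1 + 3) + 1)
      ((s(t := rev (s r) @ s t))(r := []))"
    unfolding move_def
    by (rule runs_foreach[where S = "\<lambda>ys. s(t := rev ys @ s t)"])
      (use assms in \<open>auto intro!: runs_mono[OF runs_Push]\<close>)
  then show ?thesis
    by (rule runs_mono) (use assms in auto)
qed

definition clear :: "nat \<Rightarrow> prog" where
  "clear r = foreach r (\<lambda>_. Skip)"

lemma runs_clear: "runs (clear r) s (4 * length (s r) + 1) (s(r := []))"
proof -
  have "runs (clear r) s (length (s r) * (1 + 3) + 1) (s(r := []))"
    unfolding clear_def
    by (rule runs_foreach[where S = "\<lambda>_. s"]) (auto intro!: runs_mono[OF runs_Skip])
  then show ?thesis
    by (rule runs_mono) auto
qed

section \<open>Binary arithmetic\<close>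

fun num :: "bool list \<Rightarrow> nat" where
  "num [] = 0"
| "num (b # bs) = of_bool b + 2 * num bs"

lemma num_append: "num (xs @ ys) = num xs + 2 ^ length xs * num ys"
  by (induction xs) auto

lemma num_less: "num xs < 2 ^ length xs"
  by (induction xs) (auto simp: of_bool_def)

lemma num_binary [simp]: "num (binary n) = n"
proof (induction n rule: less_induct)
  case (less n)
  show ?case
  proof (cases "n = 0")
    case False
    then have "num (binary n) = of_bool (odd n) + 2 * num (binary (n div 2))"
      by (subst binary.simps) simp
    also have "num (binary (n div 2)) = n div 2"
      using False by (intro less) simp
    finally show ?thesis
      by simp
  qed (simp add: binary.simps)
qed

lemma binary_0 [simp]: "binary 0 = []"
  by (simp add: binary.simps)

lemma binary_double: "binary (2 * n) = (if n = 0 then [] else False # binary n)"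
  and binary_Suc_double: "binary (Suc (2 * n)) = True # binary n"
  by (subst binary.simps, simp)+

lemma binary_1 [simp]: "binary (Suc 0) = [True]"
  by (subst binary.simps) simp

lemma binary_eq_Nil [simp]: "binary n = [] \<longleftrightarrow> n = 0"
  by (subst binary.simps) auto

lemma less_power_length_binary: "n < 2 ^ length (binary n)"
  using num_less[of "binary n"] by simp

lemma length_binary_le: "n < 2 ^ W \<Longrightarrow> length (binary n) \<le> W"
proof (induction W arbitrary: n)
  case (Suc W)
  then have "length (binary (n div 2)) \<le> W"
    by auto
  then show ?case
    by (subst binary.simps) simp
qed simp

text \<open>Bits arrive most significant first, and leading zeros are dropped.\<close>

definition move_norm :: "nat \<Rightarrow> nat \<Rightarrow> prog" where
  "move_norm r t = foreach r (\<lambda>b. Switch t (if b then Push t True else Skip) (Push t b) (Push t b))"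

lemma runs_move_norm:
  assumes "r \<noteq> t" "s t = []"
  shows "runs (move_norm r t) s (5 * length (s r) + 1) (s(r := [], t := binary (num (rev (s r)))))"
proof -
  have "runs (move_norm r t) s (length (s r) * (2 + 3) + 1)
      ((s(t := binary (num (rev (s r)))))(r := []))"
    unfolding move_norm_def
  \<comment> \<open>An arriving bit doubles the value read so far and is added to it. Pushing a 0
    onto an empty register would break the normal form, and in that one case nothing is
    pushed.\<close>
  proof (rule runs_foreach[where S = "\<lambda>ys. s(t := binary (num (rev ys)))"])
    fix ys x zs
    let ?s = "s(t := binary (num (rev ys)), r := zs)"
    have t: "?s t = binary (num (rev ys))"
      using assms by simp
    have "runs (Switch t (if x then Push t True else Skip) (Push t x) (Push t x)) ?s (Suc 1)
      (s(t := binary (num (rev (ys @ [x]))), r := zs))"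
      by (rule runs_Switch, unfold t)
        (use assms in \<open>auto simp: binary_double binary_Suc_double fun_upd_twist split: list.split
          intro!: runs_mono[OF runs_Push] runs_mono[OF runs_Skip]\<close>)
    then show "runs (Switch t (if x then Push t True else Skip) (Push t x) (Push t x)) ?s 2
      (s(t := binary (num (rev (ys @ [x]))), r := zs))"
      by (rule runs_mono) simp_all
  qed (use assms in \<open>auto simp: fun_eq_iff\<close>)
  then show ?thesis
    by (rule runs_mono) (use assms in auto)
qed

notation Seq (infixr \<open>;;\<close> 60)

text \<open>\<open>CLK\<close> fixes the width of numbers and \<open>INP\<close> is a second copy of
  the input. \<open>ELL\<close> is the bound, \<open>LAB\<close> the label vector,
  \<open>SEEN\<close> its consumed part in reverse. \<open>ACC\<close>, \<open>DEM\<close> and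
  \<open>ROW\<close> belong to the current vertex; \<open>TOT\<close> accumulates the budget;
  \<open>OUT\<close> is the output in reverse; \<open>BAD\<close> marks violated demands.
  \<open>SGN\<close> and \<open>THR\<close> hold the threshold, and \<open>NEG\<close> is a zero
  operand. \<open>VLOOP\<close> and \<open>DLOOP\<close> are loop flags; \<open>TMP\<close>,
  \<open>CRY\<close>, \<open>RES\<close> and \<open>SAV\<close> are scratch.\<close>

abbreviation (input) "IO \<equiv> 0 :: nat"
abbreviation (input) "INP \<equiv> 1 :: nat"
abbreviation (input) "CLK \<equiv> 2 :: nat"
abbreviation (input) "TMP \<equiv> 3 :: nat"
abbreviation (input) "ELL \<equiv> 4 :: nat"
abbreviation (input) "LAB \<equiv> 5 :: nat"
abbreviation (input) "SEEN \<equiv> 6 :: nat"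
abbreviation (input) "ACC \<equiv> 7 :: nat"
abbreviation (input) "DEM \<equiv> 8 :: nat"
abbreviation (input) "ROW \<equiv> 9 :: nat"
abbreviation (input) "TOT \<equiv> 10 :: nat"
abbreviation (input) "OUT \<equiv> 11 :: nat"
abbreviation (input) "VLOOP \<equiv> 12 :: nat"
abbreviation (input) "DLOOP \<equiv> 13 :: nat"
abbreviation (input) "CRY \<equiv> 14 :: nat"
abbreviation (input) "RES \<equiv> 15 :: nat"
abbreviation (input) "SAV \<equiv> 16 :: nat"
abbreviation (input) "BAD \<equiv> 17 :: nat"
abbreviation (input) "SGN \<equiv> 18 :: nat"
abbreviation (input) "THR \<equiv> 19 :: nat"
abbreviation (input) "NEG \<equiv> 20 :: nat"

section \<open>Ripple-carry addition and subtraction of fixed width\<close>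

definition bit_at :: "bool list \<Rightarrow> nat \<Rightarrow> bool" where
  "bit_at xs i = top_bit (drop i xs)"

definition majority :: "bool \<Rightarrow> bool \<Rightarrow> bool \<Rightarrow> bool" where
  "majority x y z \<longleftrightarrow> x \<and> y \<or> x \<and> z \<or> y \<and> z"

text \<open>The carry of the addition, or if \<open>neg\<close> holds the borrow of the subtraction, into position \<open>i\<close>.\<close>

primrec carry :: "bool \<Rightarrow> bool list \<Rightarrow> bool list \<Rightarrow> nat \<Rightarrow> bool" where
  "carry neg a b 0 = False"
| "carry neg a b (Suc i) = majority (bit_at a i \<noteq> neg) (bit_at b i) (carry neg a b i)"

text \<open>Sum and difference agree modulo 2, so \<open>neg\<close> enters only through the carry:
  a borrow is the majority of the complemented minuend bit, the subtrahend bit and the previous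
  borrow.\<close>

definition digit :: "bool \<Rightarrow> bool list \<Rightarrow> bool list \<Rightarrow> nat \<Rightarrow> bool" where
  "digit neg a b i = ((bit_at a i \<noteq> bit_at b i) \<noteq> carry neg a b i)"

abbreviation bits_below :: "(nat \<Rightarrow> bool) \<Rightarrow> nat \<Rightarrow> bool list" where
  "bits_below f n \<equiv> map f [0..<n]"

lemma carry_add:
  "num (bits_below (digit False a b) n) + of_bool (carry False a b n) * 2 ^ n =
   num (bits_below (bit_at a) n) + num (bits_below (bit_at b) n)"
proof (induction n)
  case (Suc n)
  then show ?case
    by (cases "bit_at a n"; cases "bit_at b n"; cases "carry False a b n")
      (simp_all add: num_append digit_def majority_def)
qed simp

text \<open>Subtraction in additive form, free of truncation: an outgoing borrow is a loan of
  \<open>2 ^ n\<close> on the side of the minuend.\<close>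

lemma carry_sub:
  "num (bits_below (digit True a b) n) + num (bits_below (bit_at b) n) =
   num (bits_below (bit_at a) n) + of_bool (carry True a b n) * 2 ^ n"
proof (induction n)
  case (Suc n)
  then show ?case
    by (cases "bit_at a n"; cases "bit_at b n"; cases "carry True a b n")
      (simp_all add: num_append digit_def majority_def)
qed simp

lemma num_bits_below_bit_at:
  "length xs \<le> n \<Longrightarrow> num (bits_below (bit_at xs) n) = num xs"
proof (induction xs arbitrary: n)
  case Nil
  show ?case
    by (induction n) (simp_all add: num_append bit_at_def)
next
  case (Cons x xs)
  then obtain m where m: "n = Suc m"
    by (cases n) auto
  have "bits_below (bit_at (x # xs)) n = x # bits_below (bit_at xs) m"
    unfolding m map_upt_Suc by (simp add: bit_at_def)
  then show ?case
    using Cons m by simp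
qed

text \<open>Reading consumes a register, so the clock bit and the second operand are saved in
  \<open>TMP\<close> and \<open>SAV\<close>; the first operand is replaced by the result
  anyway.\<close>

definition arith_step :: "bool \<Rightarrow> nat \<Rightarrow> nat \<Rightarrow> bool \<Rightarrow> prog" where
  "arith_step neg A B z = Push TMP z ;; pop_bit A (\<lambda>x. pop_bit B (\<lambda>y. pop_bit CRY (\<lambda>c.
     Push RES ((x \<noteq> y) \<noteq> c) ;; Push SAV y ;; Push CRY (majority (x \<noteq> neg) y c))))"

text \<open>
  Only the length of the string in register \<open>CLK\<close> matters: all numbers are treated as having that many
  bits, empty registers supplying zeros.
\<close>

definition arith :: "bool \<Rightarrow> nat \<Rightarrow> nat \<Rightarrow> prog" where
  "arith neg A B = Push CRY False ;; foreach CLK (arith_step neg A B) ;;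
     move TMP CLK ;; move_norm RES A ;; move_norm SAV B"

definition arith_regs :: "nat set" where
  "arith_regs = {CLK, TMP, CRY, RES, SAV}"

definition arith_ready :: "regs \<Rightarrow> bool" where
  "arith_ready s \<longleftrightarrow> s TMP = [] \<and> s CRY = [] \<and> s RES = [] \<and> s SAV = []"

text \<open>Digits are produced from the low end, so \<open>RES\<close> and \<open>SAV\<close>
  finish with the most significant bit on top, the order that \<open>move_norm\<close> expects. The
  last carry stays in \<open>CRY\<close> for the caller, which is how numbers are compared. Per bit,
  13 units go into the loop, 4 into restoring the clock and 5 into each normalization.\<close>

lemma runs_arith:
  assumes regs: "A \<notin> arith_regs" "B \<notin> arith_regs" "A \<noteq> B"
    and ready: "arith_ready s"
    and W: "W = length (s CLK)"
    and ab: "s A = binary a" "s B = binary b" "a < 2 ^ W" "b < 2 ^ W"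
  shows "runs (arith neg A B) s (27 * W + 6)
    (s(A := binary (num (bits_below (digit neg (binary a) (binary b)) W)),
       CRY := [carry neg (binary a) (binary b) W]))"
proof -
  note r = regs[unfolded arith_regs_def, simplified] ready[unfolded arith_ready_def]
  let ?a = "binary a" and ?b = "binary b"
  let ?S = "\<lambda>ys. s(TMP := rev ys, A := drop (length ys) ?a, B := drop (length ys) ?b,
      RES := rev (bits_below (digit neg ?a ?b) (length ys)),
      SAV := rev (bits_below (bit_at ?b) (length ys)), CRY := [carry neg ?a ?b (length ys)])"
  have len: "length ?a \<le> W" "length ?b \<le> W"
    using ab length_binary_le by auto
  have step: "runs (arith_step neg A B x) ((?S ys)(CLK := zs)) 10 ((?S (ys @ [x]))(CLK := zs))"
    for ys x zs
  proof -
    have "runs (arith_step neg A B x) ((?S ys)(CLK := zs))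
        (1 + ((((1 + (1 + 1)) + 2) + 2) + 2)) ((?S (ys @ [x]))(CLK := zs))"
      unfolding arith_step_def
      apply (rule runs_Seq[OF runs_Push])
      apply (rule runs_pop_bit runs_Seq[OF runs_Push] runs_mono[OF runs_Push])+
       apply simp
      apply (rule ext)
      using r by (auto simp: bit_at_def[symmetric] digit_def tl_drop drop_Suc[symmetric])
    then show ?thesis
      by (rule runs_mono) simp_all
  qed
  let ?s0 = "s(CRY := [False])" and ?s1 = "(?S (s CLK))(CLK := [])"
  let ?s2 = "?s1(TMP := [], CLK := s CLK)"
  let ?s3 = "?s2(RES := [], A := binary (num (bits_below (digit neg ?a ?b) W)))"
  let ?s4 = "s(A := binary (num (bits_below (digit neg ?a ?b) W)), CRY := [carry neg ?a ?b W])"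
  have 0: "runs (Push CRY False) s 1 ?s0"
    by (rule runs_mono[OF runs_Push]) (use r in auto)
  have 1: "runs (foreach CLK (arith_step neg A B)) ?s0 (W * (10 + 3) + 1) ?s1"
    unfolding W by (rule runs_foreach[where S = ?S, OF step]) (use r ab in \<open>auto simp: fun_eq_iff\<close>)
  have 2: "runs (move TMP CLK) ?s1 (4 * W + 1) ?s2"
    by (rule runs_mono[OF runs_move]) (use r W in auto)
  have 3: "runs (move_norm RES A) ?s2 (5 * W + 1) ?s3"
    by (rule runs_mono[OF runs_move_norm]) (use r W len in auto)
  have 4: "runs (move_norm SAV B) ?s3 (5 * W + 1) ?s4"
    by (rule runs_mono[OF runs_move_norm])
      (use r W len ab num_bits_below_bit_at in \<open>auto simp: fun_eq_iff\<close>)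
  have "runs (arith neg A B) s
      (1 + ((W * (10 + 3) + 1) + ((4 * W + 1) + ((5 * W + 1) + (5 * W + 1))))) ?s4"
    unfolding arith_def by (intro runs_Seq[OF 0] runs_Seq[OF 1] runs_Seq[OF 2] runs_Seq[OF 3] 4)
  then show ?thesis
    by (rule runs_mono) simp_all
qed


definition add :: "nat \<Rightarrow> nat \<Rightarrow> prog" where
  "add A B = arith False A B ;; Pop CRY"

lemma runs_add:
  assumes regs: "A \<notin> arith_regs" "B \<notin> arith_regs" "A \<noteq> B"
    and ready: "arith_ready s"
    and ab: "s A = binary a" "s B = binary b" "a + b < 2 ^ length (s CLK)"
  shows "runs (add A B) s (27 * length (s CLK) + 7) (s(A := binary (a + b)))"
proof -
  let ?W = "length (s CLK)" and ?a = "binary a" and ?b = "binary b"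
  have less: "a < 2 ^ ?W" "b < 2 ^ ?W"
    using ab by auto
  have sum: "num (bits_below (digit False ?a ?b) ?W) + of_bool (carry False ?a ?b ?W) * 2 ^ ?W = a + b"
    unfolding carry_add using less by (simp add: num_bits_below_bit_at length_binary_le)
  then have "\<not> carry False ?a ?b ?W"
    using ab(3) by (intro notI) simp
  with sum have sum: "num (bits_below (digit False ?a ?b) ?W) = a + b"
    by simp
  have "runs (add A B) s (27 * ?W + 6 + 1) (s(A := binary (a + b)))"
    unfolding add_def
    using regs ready
    by (intro runs_Seq[OF runs_arith[OF regs ready refl ab(1,2) less]] runs_mono[OF runs_Pop])
      (auto simp: sum arith_regs_def arith_ready_def)
  then show ?thesis
    by (rule runs_mono) simp_all
qed

definition sub :: "nat \<Rightarrow> nat \<Rightarrow> prog" where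
  "sub A B = arith True A B"

text \<open>If \<open>a < b\<close>, the result is the two's complement of \<open>b - a\<close>.\<close>

lemma runs_sub:
  assumes regs: "A \<notin> arith_regs" "B \<notin> arith_regs" "A \<noteq> B"
    and ready: "arith_ready s"
    and W: "W = length (s CLK)"
    and ab: "s A = binary a" "s B = binary b" "a < 2 ^ W" "b < 2 ^ W"
  shows "runs (sub A B) s (27 * W + 6)
    (s(A := binary (if a < b then 2 ^ W + a - b else a - b), CRY := [a < b]))"
proof -
  let ?a = "binary a" and ?b = "binary b"
  let ?d = "num (bits_below (digit True ?a ?b) W)"
  have diff: "?d + b = a + of_bool (carry True ?a ?b W) * 2 ^ W"
    using carry_sub[of ?a ?b W] ab by (simp add: num_bits_below_bit_at length_binary_le)
  have "?d < 2 ^ W"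
    using num_less[of "bits_below (digit True ?a ?b) W"] by simp
  with diff have "carry True ?a ?b W \<longleftrightarrow> a < b"
    using ab by (cases "carry True ?a ?b W") auto
  moreover from this diff have "?d = (if a < b then 2 ^ W + a - b else a - b)"
    by auto
  ultimately show ?thesis
    using runs_arith[OF regs ready W ab, of True] unfolding sub_def by simp
qed

section \<open>Complementing an instance\<close>

text \<open>A vertex is given by its label (1 if free), its demand and its row of the adjacency matrix.\<close>

type_synonym vertex = "bool \<times> nat \<times> bool list"

fun vertex_bits :: "vertex \<Rightarrow> bool list" where
  "vertex_bits (l, k, row) = l # delimited (binary k) @ delimited row"

definition instance_bits :: "nat \<Rightarrow> vertex list \<Rightarrow> bool list" where
  "instance_bits ell V = delimited (binary ell) @ concat (map (\<lambda>v. True # vertex_bits v) V) @ [False]"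

definition hits :: "bool list \<Rightarrow> bool list \<Rightarrow> nat" where
  "hits row labs = length (filter (\<lambda>(x, l). x \<and> l) (zip row labs))"

text \<open>The adjacency row of a loopless graph has 0 at the vertex itself, so the closed
  neighbourhood needs the own label \<open>l\<close> as an extra summand.\<close>

fun capacity :: "nat \<Rightarrow> bool list \<Rightarrow> vertex \<Rightarrow> nat" where
  "capacity ell labs (l, k, row) = ell * (of_bool l + hits row labs)"

fun complement_vertex :: "nat \<Rightarrow> bool list \<Rightarrow> vertex \<Rightarrow> vertex" where
  "complement_vertex ell labs (l, k, row) = (l, capacity ell labs (l, k, row) - k, row)"

fun infeasible :: "nat \<Rightarrow> bool list \<Rightarrow> vertex \<Rightarrow> bool" where
  "infeasible ell labs (l, k, row) \<longleftrightarrow> capacity ell labs (l, k, row) < k"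

lemma length_delimited [simp]: "length (delimited bs) = 2 * length bs + 1"
  by (induction bs) (auto simp: delimited_def)

lemma hits_snoc:
  "length ys < length labs \<Longrightarrow> hits (ys @ [x]) labs = hits ys labs + of_bool (x \<and> labs ! length ys)"
proof (induction ys arbitrary: labs)
  case Nil
  then show ?case by (cases labs) (auto simp: hits_def)
next
  case (Cons y ys)
  then show ?case by (cases labs) (auto simp: hits_def)
qed

lemma hits_le: "hits row labs \<le> length labs"
  unfolding hits_def by (rule order_trans[OF length_filter_le]) simp

section \<open>Reading, complementing and writing one vertex\<close>

definition emit :: "nat \<Rightarrow> prog" where
  "emit r = foreach r (\<lambda>b. Push OUT True ;; Push OUT b) ;; Push OUT False"

lemma runs_emit:
  assumes "r \<noteq> OUT"
  shows "runs (emit r) s (5 * length (s r) + 2) (s(r := [], OUT := rev (delimited (s r)) @ s OUT))"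
proof -
  let ?d = "\<lambda>ys. rev (concat (map (\<lambda>b. [True, b]) ys)) @ s OUT"
  have "runs (foreach r (\<lambda>b. Push OUT True ;; Push OUT b)) s (length (s r) * ((1 + 1) + 3) + 1)
      (s(OUT := ?d (s r), r := []))"
    by (rule runs_foreach[where S = "\<lambda>ys. s(OUT := ?d ys)"])
      (use assms in \<open>auto intro!: runs_Seq[OF runs_Push, simplified] runs_mono[OF runs_Push]
        simp: fun_eq_iff\<close>)
  then have "runs (emit r) s (length (s r) * ((1 + 1) + 3) + 1 + 1)
      (s(r := [], OUT := rev (delimited (s r)) @ s OUT))"
    unfolding emit_def
    by (rule runs_Seq)
      (use assms in \<open>auto intro!: runs_mono[OF runs_Push] simp: delimited_def fun_eq_iff\<close>)
  then show ?thesis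
    by (rule runs_mono) simp_all
qed

definition receive :: "nat \<Rightarrow> nat \<Rightarrow> prog" where
  "receive i r = delim i DLOOP (Push TMP) ;; move TMP r"

lemma runs_receive:
  assumes "i \<notin> {TMP, DLOOP, r}" "r \<notin> {TMP, DLOOP}"
    and "s i = delimited xs @ us" "s r = []" "s TMP = []" "s DLOOP = []"
  shows "runs (receive i r) s (10 * length xs + 7) (s(i := us, r := xs))"
proof -
  have "runs (delim i DLOOP (Push TMP)) s (length xs * (1 + 5) + 6)
      (s(TMP := rev xs, i := us, DLOOP := []))"
    by (rule runs_delim[where S = "\<lambda>ys. s(TMP := rev ys)"])
      (use assms in \<open>auto intro!: runs_mono[OF runs_Push] simp: fun_eq_iff\<close>)
  then have "runs (receive i r) s ((length xs * (1 + 5) + 6) + (4 * length xs + 1)) (s(i := us, r := xs))"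
    unfolding receive_def
    by (rule runs_Seq)
      (use assms in \<open>auto intro!: runs_mono[OF runs_move] simp: fun_eq_iff\<close>)
  then show ?thesis
    by (rule runs_mono) simp_all
qed

definition ignore :: "nat \<Rightarrow> prog" where
  "ignore i = delim i DLOOP (\<lambda>_. Skip)"

lemma runs_ignore:
  assumes "i \<noteq> DLOOP" "s i = delimited xs @ us" "s DLOOP = []"
  shows "runs (ignore i) s (6 * length xs + 6) (s(i := us))"
proof -
  have "runs (ignore i) s (length xs * (1 + 5) + 6) (s(i := us, DLOOP := []))"
    unfolding ignore_def
    by (rule runs_delim[where S = "\<lambda>ys. s"])
      (use assms in \<open>auto intro!: runs_mono[OF runs_Skip] simp: fun_eq_iff\<close>)
  then show ?thesis
    by (rule runs_mono) (use assms in \<open>auto simp: fun_eq_iff\<close>)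
qed

text \<open>\<open>LAB\<close> is consumed in parallel with the row and collected in
  \<open>SEEN\<close> for the next vertex; the row is kept in \<open>ROW\<close> because it recurs
  in the output.\<close>

definition row_step :: "bool \<Rightarrow> prog" where
  "row_step x = Push ROW x ;; pop_bit LAB (\<lambda>l. Push SEEN l ;; (if x \<and> l then add ACC ELL else Skip))"

definition vertex_step :: prog where
  "vertex_step = Push OUT True ;;
     pop_bit IO (\<lambda>l. Push OUT l ;; (if l then add ACC ELL ;; add TOT ELL else Skip)) ;;
     receive IO DEM ;; delim IO DLOOP row_step ;; move SEEN LAB ;; sub ACC DEM ;;
     pop_bit CRY (\<lambda>c. if c then clear ACC ;; Push BAD True else Skip) ;;
     clear DEM ;; emit ACC ;; move ROW TMP ;; emit TMP"

lemma runs_row: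
  assumes s: "s IO = delimited row @ us" "s ELL = binary ell" "s LAB = labs" "s SEEN = []"
      "s ACC = binary a" "s ROW = []" "s DLOOP = []" "arith_ready s"
    and len: "length row = length labs"
    and W: "length (s CLK) = W" "a + ell * length labs < 2 ^ W"
  shows "runs (delim IO DLOOP row_step) s (length row * (27 * W + 16) + 6)
    (s(IO := us, LAB := [], SEEN := rev labs, ROW := rev row, ACC := binary (a + ell * hits row labs)))"
proof -
  let ?S = "\<lambda>ys. s(LAB := drop (length ys) labs, SEEN := rev (take (length ys) labs), ROW := rev ys,
      ACC := binary (a + ell * hits ys labs))"
  have "runs (delim IO DLOOP row_step) s (length row * ((27 * W + 11) + 5) + 6)
    ((?S row)(IO := us, DLOOP := []))"
  proof (rule runs_delim[where S = ?S])
    fix ys x zs vs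
    assume row: "row = ys @ x # zs"
    then have less: "length ys < length labs"
      using len by simp
    let ?s = "(?S ys)(IO := vs, DLOOP := [True])" and ?t = "(?S (ys @ [x]))(IO := vs, DLOOP := [True])"
    let ?l = "labs ! length ys"
    have drop: "drop (length ys) labs = ?l # drop (Suc (length ys)) labs"
      using less by (rule Cons_nth_drop_Suc[symmetric])
    have take: "take (Suc (length ys)) labs = take (length ys) labs @ [?l]"
      using less by (rule take_Suc_conv_app_nth)
    let ?s' = "?s(ROW := x # rev ys, LAB := drop (Suc (length ys)) labs,
        SEEN := ?l # rev (take (length ys) labs))"
    \<comment> \<open>At most \<open>length labs\<close> additions take place along the row, so no
      intermediate sum exceeds the clock width.\<close>
    have bound: "a + ell * hits ys labs + (if x \<and> ?l then ell else 0) < 2 ^ W"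
    proof -
      have "hits ys labs + of_bool (x \<and> ?l) \<le> length labs"
        using hits_snoc[OF less, of x] hits_le[of "ys @ [x]" labs] by simp
      then have "ell * (hits ys labs + of_bool (x \<and> ?l)) \<le> ell * length labs"
        by (rule mult_le_mono2)
      then show ?thesis
        using W(2) by (auto simp: algebra_simps split: if_splits)
    qed
    have "runs (if x \<and> ?l then add ACC ELL else Skip) ?s' (27 * W + 7) ?t"
    proof (cases "x \<and> ?l")
      case True
      then have "runs (add ACC ELL) ?s' (27 * W + 7) ?t"
        using s W bound
        by (intro runs_mono[OF runs_add[where a = "a + ell * hits ys labs" and b = ell]])
          (auto simp: arith_regs_def arith_ready_def hits_snoc[OF less] take fun_eq_iff algebra_simps)
      with True show ?thesis
        by simp
    next
      case False
      then show ?thesis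
        by (auto intro!: runs_mono[OF runs_Skip] simp: hits_snoc[OF less] take fun_eq_iff)
    qed
    then have "runs (Push SEEN ?l ;; (if x \<and> ?l then add ACC ELL else Skip))
        (?s(ROW := x # rev ys, LAB := drop (Suc (length ys)) labs)) (1 + (27 * W + 7)) ?t"
      by (intro runs_Seq[OF runs_mono[OF runs_Push]]) (auto simp: fun_eq_iff)
    then have "runs (pop_bit LAB (\<lambda>l. Push SEEN l ;; (if x \<and> l then add ACC ELL else Skip)))
        (?s(ROW := x # rev ys)) ((1 + (27 * W + 7)) + 2) ?t"
      by (intro runs_pop_bit) (simp add: drop fun_upd_twist)
    then have "runs (row_step x) ?s (1 + ((1 + (27 * W + 7)) + 2)) ?t"
      unfolding row_step_def
      by (intro runs_Seq[OF runs_mono[OF runs_Push]]) (auto simp: fun_eq_iff)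
    then show "runs (row_step x) ?s (27 * W + 11) ?t"
      by (rule runs_mono) auto
  qed (use s in \<open>auto simp: fun_eq_iff hits_def\<close>)
  then show ?thesis
    by (rule runs_mono) (use s len in \<open>auto simp: fun_eq_iff\<close>)
qed

text \<open>Up to \<open>W\<close> row entries, each with an addition linear in \<open>W\<close>,
  account for the square. The registers of the current vertex are empty again afterwards and
  \<open>LAB\<close> is restored, so the step can be iterated.\<close>

lemma runs_vertex_step:
  assumes s: "s IO = vertex_bits v @ us" "s ELL = binary ell" "s LAB = labs" "s SEEN = []"
      "s ACC = []" "s DEM = []" "s ROW = []" "s DLOOP = []" "s TOT = binary t" "arith_ready s"
    and v: "v = (l, k, row)"
    and len: "length row = length labs" "length labs \<le> W"
    and W: "length (s CLK) = W" "ell * (length labs + 1) < 2 ^ W" "k < 2 ^ W" "t + ell * of_bool l < 2 ^ W"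
  shows "runs vertex_step s (200 * (W + 1) ^ 2)
    (s(IO := us, TOT := binary (t + ell * of_bool l),
       OUT := rev (True # vertex_bits (complement_vertex ell labs v)) @ s OUT,
       BAD := (if infeasible ell labs v then True # s BAD else s BAD)))"
proof -
  let ?c = "capacity ell labs v"
  let ?o1 = "l # True # s OUT"
  let ?o2 = "rev (delimited (binary (?c - k))) @ ?o1"
  have less: "ell < 2 ^ W" "ell + ell * length labs < 2 ^ W"
    using W(2) by (auto simp: algebra_simps)
  have c: "?c < 2 ^ W"
  proof -
    have "of_bool l + hits row labs \<le> length labs + 1"
      using hits_le[of row labs] by (cases l) auto
    then have "?c \<le> ell * (length labs + 1)"
      unfolding v capacity.simps by (rule mult_le_mono2)
    then show ?thesis
      using W(2) by simp
  qed
  let ?s1 = "s(OUT := True # s OUT)"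
  let ?s2 = "s(IO := delimited (binary k) @ delimited row @ us, OUT := ?o1, ACC := binary (ell * of_bool l),
      TOT := binary (t + ell * of_bool l))"
  let ?s3 = "?s2(IO := delimited row @ us, DEM := binary k)"
  let ?s4 = "?s3(IO := us, LAB := [], SEEN := rev labs, ROW := rev row, ACC := binary ?c)"
  let ?s5 = "?s4(LAB := labs, SEEN := [])"
  let ?s6 = "?s5(ACC := binary (if ?c < k then 2 ^ W + ?c - k else ?c - k), CRY := [?c < k])"
  let ?s7 = "?s5(ACC := binary (?c - k), BAD := (if ?c < k then True # s BAD else s BAD))"
  let ?s8 = "?s7(DEM := [])"
  let ?s9 = "?s8(ACC := [], OUT := ?o2)"
  let ?s10 = "?s9(ROW := [], TMP := row)"
  let ?s11 = "?s10(TMP := [], OUT := rev (delimited row) @ ?o2)"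
  have ready: "s TMP = []" "s CRY = []" "s RES = []" "s SAV = []"
    using s(10) by (auto simp: arith_ready_def)
  have 1: "runs (Push OUT True) s 1 ?s1"
    by (rule runs_Push)
  have 2: "runs (pop_bit IO (\<lambda>l. Push OUT l ;; (if l then add ACC ELL ;; add TOT ELL else Skip)))
      ?s1 ((1 + ((27 * W + 7) + (27 * W + 7))) + 2) ?s2"
  proof (rule runs_pop_bit, rule runs_Seq[OF runs_Push])
    let ?r = "s(IO := delimited (binary k) @ delimited row @ us, OUT := ?o1)"
    have "runs (if l then add ACC ELL ;; add TOT ELL else Skip) ?r ((27 * W + 7) + (27 * W + 7)) ?s2"
    proof (cases l)
      case True
      have a: "runs (add ACC ELL) ?r (27 * W + 7) (?r(ACC := binary ell))"
        using s W less
        by (intro runs_mono[OF runs_add[where a = 0 and b = ell]])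
          (auto simp: arith_regs_def arith_ready_def fun_eq_iff)
      have b: "runs (add TOT ELL) (?r(ACC := binary ell)) (27 * W + 7) ?s2"
        using s W less True
        by (intro runs_mono[OF runs_add[where a = t and b = ell]])
          (auto simp: arith_regs_def arith_ready_def fun_eq_iff)
      show ?thesis
        using True runs_Seq[OF a b] by simp
    next
      case False
      then show ?thesis
        using s by (auto intro!: runs_mono[OF runs_Skip] simp: fun_eq_iff)
    qed
    then show "runs (if top_bit (?s1 IO) then add ACC ELL ;; add TOT ELL else Skip)
       (?s1(IO := tl (?s1 IO), OUT := top_bit (?s1 IO) # (?s1(IO := tl (?s1 IO))) OUT))
       ((27 * W + 7) + (27 * W + 7)) ?s2"
      using s v by (simp add: fun_upd_twist)
  qed
  have 3: "runs (receive IO DEM) ?s2 (10 * W + 7) ?s3"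
    using s ready length_binary_le[OF W(3)]
    by (intro runs_mono[OF runs_receive[where xs = "binary k" and us = "delimited row @ us"]])
      (auto simp: fun_eq_iff)
  have 4: "runs (delim IO DLOOP row_step) ?s3 (W * (27 * W + 16) + 6) ?s4"
    using s W len less ready
    by (intro runs_mono[OF runs_row[where row = row and us = us and ell = ell and labs = labs
            and a = "ell * of_bool l" and W = W]])
      (auto simp: arith_ready_def fun_eq_iff v algebra_simps of_bool_def intro!: add_mono mult_le_mono)
  have 5: "runs (move SEEN LAB) ?s4 (4 * W + 1) ?s5"
    using len by (intro runs_mono[OF runs_move]) (auto simp: fun_eq_iff)
  have 6: "runs (sub ACC DEM) ?s5 (27 * W + 6) ?s6"
    using s W c ready
    by (intro runs_mono[OF runs_sub[where a = ?c and b = k and W = W]])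
      (auto simp: arith_regs_def arith_ready_def fun_eq_iff)
  \<comment> \<open>After a borrow \<open>ACC\<close> holds a two's complement; it is replaced by
    the 0 of truncated subtraction, and the violated demand is marked in \<open>BAD\<close>.\<close>
  have 7: "runs (pop_bit CRY (\<lambda>c. if c then clear ACC ;; Push BAD True else Skip)) ?s6
      (((4 * W + 1) + 1) + 2) ?s7"
  proof (rule runs_pop_bit)
    have "runs (if ?c < k then clear ACC ;; Push BAD True else Skip) (?s6(CRY := []))
        ((4 * W + 1) + 1) ?s7"
    proof (cases "?c < k")
      case True
      have "length (binary (2 ^ W + ?c - k)) \<le> W"
        using True W(3) by (intro length_binary_le) linarith
      then have "runs (clear ACC) (?s6(CRY := [])) (4 * W + 1) (?s6(CRY := [], ACC := []))"
        using True by (intro runs_mono[OF runs_clear]) auto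
      then have "runs (clear ACC ;; Push BAD True) (?s6(CRY := [])) ((4 * W + 1) + 1) ?s7"
        by (rule runs_Seq) (use True ready in \<open>auto intro!: runs_mono[OF runs_Push] simp: fun_eq_iff\<close>)
      with True show ?thesis
        by simp
    next
      case False
      then show ?thesis
        using ready by (auto intro!: runs_mono[OF runs_Skip] simp: fun_eq_iff)
    qed
    then show "runs (if top_bit (?s6 CRY) then clear ACC ;; Push BAD True else Skip)
        (?s6(CRY := tl (?s6 CRY))) ((4 * W + 1) + 1) ?s7"
      by simp
  qed
  have 8: "runs (clear DEM) ?s7 (4 * W + 1) ?s8"
    using length_binary_le[OF W(3)] by (intro runs_mono[OF runs_clear]) (auto simp: fun_eq_iff)
  have 9: "runs (emit ACC) ?s8 (5 * W + 2) ?s9"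
    using c by (intro runs_mono[OF runs_emit]) (auto simp: fun_eq_iff intro!: length_binary_le)
  have 10: "runs (move ROW TMP) ?s9 (4 * W + 1) ?s10"
    using len ready by (intro runs_mono[OF runs_move]) (auto simp: fun_eq_iff)
  have 11: "runs (emit TMP) ?s10 (5 * W + 2) ?s11"
    using len by (intro runs_mono[OF runs_emit]) (auto simp: fun_eq_iff)
  have time: "1 + (((1 + ((27 * W + 7) + (27 * W + 7))) + 2) + ((10 * W + 7) + ((W * (27 * W + 16) + 6) +
      ((4 * W + 1) + ((27 * W + 6) + ((((4 * W + 1) + 1) + 2) + ((4 * W + 1) + ((5 * W + 2) +
      ((4 * W + 1) + (5 * W + 2)))))))))) \<le> 200 * (W + 1) ^ 2"
    by (simp add: algebra_simps power2_eq_square)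
  show ?thesis
    unfolding vertex_step_def
    by (rule runs_mono[OF runs_Seq[OF 1 runs_Seq[OF 2 runs_Seq[OF 3 runs_Seq[OF 4 runs_Seq[OF 5
      runs_Seq[OF 6 runs_Seq[OF 7 runs_Seq[OF 8 runs_Seq[OF 9 runs_Seq[OF 10 11]]]]]]]]]] time])
      (use s ready v in \<open>auto simp: fun_eq_iff\<close>)
qed

definition duplicate :: "nat \<Rightarrow> nat \<Rightarrow> prog" where
  "duplicate r t = move r TMP ;; foreach TMP (\<lambda>x. Push r x ;; Push t x)"

lemma runs_duplicate:
  assumes "r \<noteq> t" "r \<noteq> TMP" "t \<noteq> TMP" "s TMP = []" "s t = []"
  shows "runs (duplicate r t) s (9 * length (s r) + 2) (s(t := s r))"
proof -
  have 1: "runs (move r TMP) s (4 * length (s r) + 1) (s(r := [], TMP := rev (s r)))"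
    using assms by (intro runs_mono[OF runs_move]) auto
  have 2: "runs (foreach TMP (\<lambda>x. Push r x ;; Push t x)) (s(r := [], TMP := rev (s r)))
      (length (rev (s r)) * ((1 + 1) + 3) + 1) (s(r := rev (rev (s r)), t := rev (rev (s r)), TMP := []))"
    by (rule runs_foreach[where S = "\<lambda>ys. s(r := rev ys, t := rev ys)"])
      (use assms in \<open>auto intro!: runs_Seq[OF runs_Push, simplified] runs_mono[OF runs_Push]
        simp: fun_eq_iff\<close>)
  show ?thesis
    unfolding duplicate_def
    by (rule runs_mono[OF runs_Seq[OF 1 2]]) (use assms in \<open>auto simp: fun_eq_iff\<close>)
qed

definition label_step :: prog where
  "label_step = pop_bit INP (Push SEEN) ;; ignore INP ;; ignore INP"

text \<open>Two passes, because a row refers to the labels of vertices that come later. The bound is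
  read once more into \<open>DEM\<close> because \<open>emit\<close> destroys the register that it
  writes, while \<open>ELL\<close> is still needed.\<close>

definition complement_prog :: prog where
  "complement_prog = duplicate IO INP ;; receive INP ELL ;; items INP VLOOP label_step ;; move SEEN LAB ;;
     receive IO DEM ;; emit DEM ;; items IO VLOOP vertex_step ;; Push OUT False ;; move OUT IO"

definition well_formed :: "vertex list \<Rightarrow> bool" where
  "well_formed V \<longleftrightarrow> (\<forall>(l, k, row) \<in> set V. length row = length V)"

definition labels :: "vertex list \<Rightarrow> bool list" where
  "labels V = map fst V"

definition free_total :: "nat \<Rightarrow> vertex list \<Rightarrow> nat" where
  "free_total ell V = ell * length (filter id (labels V))"

lemma length_vertex_bits_le:
  assumes "v \<in> set V"
  shows "length (vertex_bits v) \<le> length (instance_bits ell V)"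
proof -
  have "length (vertex_bits v) \<le> length (concat (map (\<lambda>v. True # vertex_bits v) V))"
    using assms by (induction V) auto
  then show ?thesis
    by (simp add: instance_bits_def)
qed

text \<open>Why the code length suffices as width: every vertex contributes at least one bit besides
  those of \<open>binary ell\<close>, and \<open>n + 1 \<le> 2 ^ n\<close> turns the product of
  bound and vertex number into a sum of lengths.\<close>

lemma instance_bits_bounds:
  assumes "length (instance_bits ell V) \<le> W"
  shows "length V \<le> W" and "length (binary ell) \<le> W" and "ell * (length V + 1) < 2 ^ W"
    and "\<And>l k row. (l, k, row) \<in> set V \<Longrightarrow> k < 2 ^ W"
    and "\<And>l k row. (l, k, row) \<in> set V \<Longrightarrow> length (binary k) \<le> W"
proof -
  have "length V \<le> length (concat (map (\<lambda>v. True # vertex_bits v) V))"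
    by (induction V) auto
  then have le: "length (binary ell) + length V \<le> W"
    using assms by (simp add: instance_bits_def)
  then show "length V \<le> W" "length (binary ell) \<le> W"
    by auto
  have "n + 1 \<le> 2 ^ n" for n :: nat
    by (induction n) auto
  then have "ell * (length V + 1) \<le> ell * 2 ^ length V"
    by (rule mult_le_mono2)
  also have "\<dots> < 2 ^ length (binary ell) * 2 ^ length V"
    using less_power_length_binary by (intro mult_strict_right_mono) auto
  also have "\<dots> \<le> 2 ^ W"
    unfolding power_add[symmetric] using le by (intro power_increasing) auto
  finally show "ell * (length V + 1) < 2 ^ W" .
  fix l k row
  assume "(l, k, row) \<in> set V"
  from length_vertex_bits_le[OF this, of ell] show *: "length (binary k) \<le> W"
    using assms by simp
  show "k < 2 ^ W"
    by (rule order_less_le_trans[OF less_power_length_binary power_increasing[OF *]]) simp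
qed

lemma free_total_le: "free_total ell V \<le> ell * length V"
  unfolding free_total_def labels_def
  by (intro mult_le_mono2) (metis length_filter_le length_map)

lemma free_total_append: "free_total ell (xs @ ys) = free_total ell xs + free_total ell ys"
  by (simp add: free_total_def labels_def algebra_simps)

lemma runs_labels:
  assumes s: "s INP = concat (map (\<lambda>v. True # vertex_bits v) V) @ [False]"
      "s SEEN = []" "s VLOOP = []" "s DLOOP = []"
    and W: "length V \<le> W" "\<And>l k row. (l, k, row) \<in> set V \<Longrightarrow> length (binary k) \<le> W"
    and wf: "well_formed V"
  shows "runs (items INP VLOOP label_step) s (W * (12 * W + 18) + 6)
    (s(INP := [], SEEN := rev (labels V)))"
proof -
  have "runs (items INP VLOOP label_step) s (length V * ((12 * W + 15) + 3) + 6)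
    (s(SEEN := rev (labels V), INP := [], VLOOP := []))"
  proof (rule runs_items[where S = "\<lambda>ys. s(SEEN := rev (labels ys))" and enc = vertex_bits])
    fix ys x zs us
    assume V: "V = ys @ x # zs"
    obtain l k row where x: "x = (l, k, row)"
      by (cases x)
    then have mem: "(l, k, row) \<in> set V"
      using V by auto
    have row: "length row \<le> W"
      using wf mem W by (auto simp: well_formed_def)
    let ?t = "\<lambda>bs. s(SEEN := rev (labels (ys @ [x])), INP := bs, VLOOP := [True])"
    have 1: "runs (pop_bit INP (Push SEEN))
        (s(SEEN := rev (labels ys), INP := vertex_bits x @ us, VLOOP := [True])) (1 + 2)
        (?t (delimited (binary k) @ delimited row @ us))"
      by (intro runs_pop_bit runs_mono[OF runs_Push]) (auto simp: x labels_def fun_eq_iff)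
    have 2: "runs (ignore INP) (?t (delimited (binary k) @ delimited row @ us)) (6 * W + 6)
        (?t (delimited row @ us))"
      using s W(2)[OF mem]
      by (intro runs_mono[OF runs_ignore[where xs = "binary k" and us = "delimited row @ us"]])
        (auto simp: fun_eq_iff)
    have 3: "runs (ignore INP) (?t (delimited row @ us)) (6 * W + 6) (?t us)"
      using s row by (intro runs_mono[OF runs_ignore[where xs = row and us = us]]) (auto simp: fun_eq_iff)
    show "runs label_step (s(SEEN := rev (labels ys), INP := vertex_bits x @ us, VLOOP := [True]))
       (12 * W + 15) (?t us)"
      unfolding label_step_def
      by (rule runs_mono[OF runs_Seq[OF 1 runs_Seq[OF 2 3]]]) auto
  qed (use s in \<open>auto simp: fun_eq_iff labels_def\<close>)
  then show ?thesis
    by (rule runs_mono) (use s W in \<open>auto simp: fun_eq_iff intro!: mult_le_mono\<close>)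
qed

text \<open>The label vector is that of the whole list and stays fixed in the invariant, whereas the
  budget, the output and the marks grow with the processed prefix.\<close>

lemma runs_vertices:
  fixes ell V
  defines "labs \<equiv> labels V"
  assumes s: "s IO = concat (map (\<lambda>v. True # vertex_bits v) V) @ [False]"
      "s ELL = binary ell" "s LAB = labs" "s SEEN = []"
      "s ACC = []" "s DEM = []" "s ROW = []" "s VLOOP = []" "s DLOOP = []" "s TOT = []" "arith_ready s"
    and W: "length V \<le> W" "length (s CLK) = W" "ell * (length V + 1) < 2 ^ W"
      "\<And>l k row. (l, k, row) \<in> set V \<Longrightarrow> k < 2 ^ W"
    and wf: "well_formed V"
  shows "runs (items IO VLOOP vertex_step) s (W * (200 * (W + 1) ^ 2 + 3) + 6)
    (s(IO := [], TOT := binary (free_total ell V),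
       OUT := rev (concat (map (\<lambda>v. True # vertex_bits (complement_vertex ell labs v)) V)) @ s OUT,
       BAD := map (\<lambda>_. True) (rev (filter (infeasible ell labs) V)) @ s BAD))"
proof -
  let ?S = "\<lambda>ys. s(TOT := binary (free_total ell ys),
       OUT := rev (concat (map (\<lambda>v. True # vertex_bits (complement_vertex ell labs v)) ys)) @ s OUT,
       BAD := map (\<lambda>_. True) (rev (filter (infeasible ell labs) ys)) @ s BAD)"
  have labs: "length labs = length V"
    by (simp add: labs_def labels_def)
  have "runs (items IO VLOOP vertex_step) s (length V * (200 * (W + 1) ^ 2 + 3) + 6)
    ((?S V)(IO := [], VLOOP := []))"
  proof (rule runs_items[where S = ?S and enc = vertex_bits])
    fix ys x zs us
    assume V: "V = ys @ x # zs"
    obtain l k row where x: "x = (l, k, row)"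
      by (cases x)
    then have mem: "(l, k, row) \<in> set V"
      using V by auto
    have row: "length row = length labs"
      using wf mem labs by (auto simp: well_formed_def)
    have step: "free_total ell (ys @ [x]) = free_total ell ys + ell * of_bool l"
      by (simp add: free_total_append x) (simp add: free_total_def labels_def)
    have "free_total ell (ys @ [x]) \<le> ell * length (ys @ [x])"
      by (rule free_total_le)
    also have "\<dots> \<le> ell * (length V + 1)"
      using V by (intro mult_le_mono2) simp
    finally have "free_total ell ys + ell * of_bool l < 2 ^ W"
      using W(3) step by simp
    then show "runs vertex_step ((?S ys)(IO := vertex_bits x @ us, VLOOP := [True]))
       (200 * (W + 1) ^ 2) ((?S (ys @ [x]))(IO := us, VLOOP := [True]))"
      using s W row labs W(4)[OF mem]
      by (intro runs_mono[OF runs_vertex_step[where v = x and us = us and ell = ell and labs = labs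
              and t = "free_total ell ys" and l = l and k = k and row = row and W = W]])
        (auto simp: step[unfolded x] fun_eq_iff arith_ready_def x)
  qed (use s in \<open>auto simp: fun_eq_iff free_total_def labels_def\<close>)
  then show ?thesis
    by (rule runs_mono) (use s W in \<open>auto simp: fun_eq_iff intro!: mult_le_mono\<close>)
qed

definition complement_bits :: "nat \<Rightarrow> vertex list \<Rightarrow> bool list" where
  "complement_bits ell V = instance_bits ell (map (complement_vertex ell (labels V)) V)"

text \<open>Complementing may lengthen the code, as a small demand can become as large as the
  capacity. Each new demand still has at most \<open>W\<close> bits and there are at most
  \<open>W\<close> vertices, hence a quadratic bound.\<close>

lemma length_complement_bits_le:
  assumes "length (instance_bits ell V) \<le> W" "well_formed V"
  shows "length (complement_bits ell V) \<le> 10 * (W + 1) ^ 2"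
proof -
  have "length (concat (map (\<lambda>v. True # vertex_bits (complement_vertex ell (labels V) v)) xs))
      \<le> length xs * (4 * W + 4)" if "set xs \<subseteq> set V" for xs
    using that
  proof (induction xs)
    case (Cons x xs)
    obtain l k row where x: "x = (l, k, row)"
      by (cases x)
    then have "length row = length V"
      using Cons assms by (auto simp: well_formed_def)
    moreover have "length (binary (ell * (of_bool l + hits row (labels V)) - k)) \<le> W"
    proof (rule length_binary_le)
      have "ell * (of_bool l + hits row (labels V)) \<le> ell * (length V + 1)"
        using hits_le[of row "labels V"] by (intro mult_le_mono2) (auto simp: labels_def)
      then show "ell * (of_bool l + hits row (labels V)) - k < 2 ^ W"
        using instance_bits_bounds(3)[OF assms(1)] by simp
    qed
    ultimately have "length (vertex_bits (complement_vertex ell (labels V) x)) \<le> 4 * W + 3"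
      using instance_bits_bounds(1)[OF assms(1)] by (simp add: x)
    then show ?case
      using Cons by simp
  qed simp
  from this[of V] have "length (complement_bits ell V) \<le> length V * (4 * W + 4) + 2 * W + 2"
    using instance_bits_bounds(2)[OF assms(1)]
    by (simp add: complement_bits_def instance_bits_def comp_def)
  also have "\<dots> \<le> W * (4 * W + 4) + 2 * W + 2"
    using instance_bits_bounds(1)[OF assms(1)] by (intro add_mono mult_le_mono) auto
  also have "\<dots> \<le> 10 * (W + 1) ^ 2"
    by (simp add: power2_eq_square algebra_simps)
  finally show ?thesis .
qed

text \<open>The clock is exempt from emptiness and \<open>W\<close> may exceed the length of the
  instance code, because in the decision problem the clock is the longer string that also contains
  the threshold.\<close>

lemma runs_complement_prog:
  assumes s: "s IO = instance_bits ell V" "\<forall>r \<in> {INP..BAD} - {CLK}. s r = []"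
    and W: "length (s CLK) = W" "length (instance_bits ell V) \<le> W"
    and wf: "well_formed V"
  shows "runs complement_prog s (1000 * (W + 1) ^ 3)
    (s(IO := complement_bits ell V, ELL := binary ell, LAB := labels V,
       TOT := binary (free_total ell V),
       BAD := map (\<lambda>_. True) (rev (filter (infeasible ell (labels V)) V))))"
proof -
  let ?v = "concat (map (\<lambda>v. True # vertex_bits v) V) @ [False]"
  let ?o = "rev (delimited (binary ell))"
  let ?o' = "rev (concat (map (\<lambda>v. True # vertex_bits (complement_vertex ell (labels V) v)) V)) @ ?o"
  let ?bad = "map (\<lambda>_. True) (rev (filter (infeasible ell (labels V)) V))"
  have empty: "s INP = []" "s TMP = []" "s ELL = []" "s LAB = []" "s SEEN = []" "s ACC = []"
      "s DEM = []" "s ROW = []" "s TOT = []" "s OUT = []" "s VLOOP = []" "s DLOOP = []"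
      "s CRY = []" "s RES = []" "s SAV = []" "s BAD = []"
    using s(2) by auto
  note b = instance_bits_bounds[OF W(2)]
  let ?s1 = "s(INP := instance_bits ell V)"
  let ?s2 = "s(INP := ?v, ELL := binary ell)"
  let ?s3 = "?s2(INP := [], SEEN := rev (labels V))"
  let ?s4 = "s(ELL := binary ell, LAB := labels V)"
  let ?s5 = "?s4(IO := ?v, DEM := binary ell)"
  let ?s6 = "?s4(IO := ?v, OUT := ?o)"
  let ?s7 = "?s4(IO := [], TOT := binary (free_total ell V), OUT := ?o', BAD := ?bad)"
  let ?s8 = "?s7(OUT := False # ?o')"
  let ?s9 = "?s4(IO := complement_bits ell V, TOT := binary (free_total ell V), BAD := ?bad)"
  have 1: "runs (duplicate IO INP) s (9 * W + 2) ?s1"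
    using s W empty by (intro runs_mono[OF runs_duplicate]) (auto simp: fun_eq_iff)
  have 2: "runs (receive INP ELL) ?s1 (10 * W + 7) ?s2"
    using empty b
    by (intro runs_mono[OF runs_receive[where xs = "binary ell" and us = ?v]])
      (auto simp: fun_eq_iff instance_bits_def)
  have 3: "runs (items INP VLOOP label_step) ?s2 (W * (12 * W + 18) + 6) ?s3"
    using empty b wf by (intro runs_mono[OF runs_labels[where V = V and W = W]]) (auto simp: fun_eq_iff)
  have 4: "runs (move SEEN LAB) ?s3 (4 * W + 1) ?s4"
    using empty b by (intro runs_mono[OF runs_move]) (auto simp: fun_eq_iff labels_def)
  have 5: "runs (receive IO DEM) ?s4 (10 * W + 7) ?s5"
    using s empty b
    by (intro runs_mono[OF runs_receive[where xs = "binary ell" and us = ?v]])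
      (auto simp: fun_eq_iff instance_bits_def)
  have 6: "runs (emit DEM) ?s5 (5 * W + 2) ?s6"
    using empty b by (intro runs_mono[OF runs_emit]) (auto simp: fun_eq_iff)
  have 7: "runs (items IO VLOOP vertex_step) ?s6 (W * (200 * (W + 1) ^ 2 + 3) + 6) ?s7"
    using empty b wf W
    by (intro runs_mono[OF runs_vertices[where V = V and ell = ell and W = W]])
      (auto simp: fun_eq_iff arith_ready_def)
  have 8: "runs (Push OUT False) ?s7 1 ?s8"
    by (intro runs_mono[OF runs_Push]) (auto simp: fun_eq_iff)
  have out: "rev (False # ?o') = complement_bits ell V"
    by (simp add: complement_bits_def instance_bits_def comp_def)
  have 9: "runs (move OUT IO) ?s8 (4 * (10 * (W + 1) ^ 2) + 1) ?s9"
  proof (rule runs_mono[OF runs_move])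
    have "length (False # ?o') = length (complement_bits ell V)"
      unfolding out[symmetric] by simp
    then show "4 * length (?s8 OUT) + 1 \<le> 4 * (10 * (W + 1) ^ 2) + 1"
      using length_complement_bits_le[OF W(2) wf] by simp
    show "?s8(OUT := [], IO := rev (?s8 OUT) @ ?s8 IO) = ?s9"
      using empty out by (auto simp: fun_eq_iff)
  qed simp
  have time: "(9 * W + 2) + ((10 * W + 7) + ((W * (12 * W + 18) + 6) + ((4 * W + 1) + ((10 * W + 7) +
      ((5 * W + 2) + ((W * (200 * (W + 1) ^ 2 + 3) + 6) + (1 + (4 * (10 * (W + 1) ^ 2) + 1))))))))
      \<le> 1000 * (W + 1) ^ 3"
    by (simp add: power2_eq_square power3_eq_cube algebra_simps)
  show ?thesis
    unfolding complement_prog_def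
    by (rule runs_mono[OF runs_Seq[OF 1 runs_Seq[OF 2 runs_Seq[OF 3 runs_Seq[OF 4 runs_Seq[OF 5
      runs_Seq[OF 6 runs_Seq[OF 7 runs_Seq[OF 8 9]]]]]]]] time]) (auto simp: fun_eq_iff)
qed

section \<open>Thresholds and optimal values\<close>

text \<open>Pushing onto \<open>IO\<close> puts bits in front of the instance, so the prefix code is
  written back to front: the closing 0 first, each bit before its announcing 1, the sign
  last.\<close>

definition announce :: "bool \<Rightarrow> nat \<Rightarrow> prog" where
  "announce b r = move r TMP ;; Push IO False ;; foreach TMP (\<lambda>x. Push IO x ;; Push IO True) ;; Push IO b"

lemma runs_announce:
  assumes "r \<noteq> TMP" "r \<noteq> IO" "s TMP = []"
  shows "runs (announce b r) s (9 * length (s r) + 4) (s(r := [], IO := b # delimited (s r) @ s IO))"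
proof -
  let ?d = "\<lambda>ys. concat (map (\<lambda>x. [True, x]) (rev ys)) @ False # s IO"
  let ?s1 = "s(r := [], TMP := rev (s r))"
  let ?s2 = "?s1(IO := False # s IO)"
  let ?s3 = "s(r := [], IO := ?d (rev (s r)), TMP := [])"
  have 1: "runs (move r TMP) s (4 * length (s r) + 1) ?s1"
    using assms by (intro runs_mono[OF runs_move]) auto
  have 2: "runs (Push IO False) ?s1 1 ?s2"
    using assms by (intro runs_mono[OF runs_Push]) auto
  have 3: "runs (foreach TMP (\<lambda>x. Push IO x ;; Push IO True)) ?s2
      (length (rev (s r)) * ((1 + 1) + 3) + 1) ?s3"
    by (rule runs_foreach[where S = "\<lambda>ys. s(r := [], IO := ?d ys)"])
      (use assms in \<open>auto intro!: runs_Seq[OF runs_Push, simplified] runs_mono[OF runs_Push]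
        simp: fun_eq_iff\<close>)
  have 4: "runs (Push IO b) ?s3 1 (s(r := [], IO := b # delimited (s r) @ s IO))"
    using assms by (intro runs_mono[OF runs_Push]) (auto simp: delimited_def fun_eq_iff)
  show ?thesis
    unfolding announce_def
    by (rule runs_mono[OF runs_Seq[OF 1 runs_Seq[OF 2 runs_Seq[OF 3 4]]]]) auto
qed

definition complement_threshold :: prog where
  "complement_threshold = pop_bit SGN (\<lambda>n.
     if n then add TOT THR ;; announce False TOT
     else sub TOT THR ;; pop_bit CRY (\<lambda>c.
       if c then sub NEG TOT ;; announce True NEG else announce False TOT))"

text \<open>Signed subtraction on magnitudes, with \<open>b\<close> the magnitude of
  \<open>B\<close>. If \<open>B\<close> is not negative and \<open>L < b\<close>, the first
  subtraction leaves \<open>2 ^ W + L - b\<close>; subtracting this from the empty register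
  \<open>NEG\<close> negates it modulo \<open>2 ^ W\<close> and yields \<open>b - L\<close>.\<close>

lemma runs_complement_threshold:
  assumes s: "s TOT = binary L" "s SGN = [B < 0]" "s THR = binary (nat \<bar>B\<bar>)" "s NEG = []" "arith_ready s"
    and W: "length (s CLK) = W" "L + nat \<bar>B\<bar> < 2 ^ W"
  shows "\<exists>s'. runs complement_threshold s (63 * W + 20) s' \<and> s' IO = decision_code (int L - B) (s IO)"
proof -
  define b where "b = nat \<bar>B\<bar>"
  note s = s[folded b_def] and W = W[folded b_def]
  let ?s = "s(SGN := [])"
  have ready: "s TMP = []" "s CRY = []" "s RES = []" "s SAV = []"
    using s(5) by (auto simp: arith_ready_def)
  let ?c = "\<lambda>n. if n then add TOT THR ;; announce False TOT
     else sub TOT THR ;; pop_bit CRY (\<lambda>c.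
       if c then sub NEG TOT ;; announce True NEG else announce False TOT)"
  have "\<exists>s'. runs (?c (B < 0)) ?s (63 * W + 18) s' \<and> s' IO = decision_code (int L - B) (s IO)"
  proof (cases "B < 0")
    case True
    let ?s1 = "?s(TOT := binary (L + b))"
    let ?s2 = "?s1(TOT := [], IO := False # delimited (binary (L + b)) @ s IO)"
    have 1: "runs (add TOT THR) ?s (27 * W + 7) ?s1"
      using s W ready
      by (intro runs_mono[OF runs_add[where a = L and b = b]]) (auto simp: arith_regs_def arith_ready_def)
    have 2: "runs (announce False TOT) ?s1 (9 * W + 4) ?s2"
      using W ready length_binary_le[OF W(2)] by (intro runs_mono[OF runs_announce]) auto
    have "runs (add TOT THR ;; announce False TOT) ?s (63 * W + 18) ?s2"
      by (rule runs_mono[OF runs_Seq[OF 1 2]]) auto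
    moreover have "nat \<bar>int L - B\<bar> = L + b" "\<not> int L - B < 0"
      using True by (auto simp: b_def)
    ultimately show ?thesis
      using True by (intro exI[of _ ?s2]) (simp add: decision_code_def)
  next
    case False
    let ?d = "if L < b then 2 ^ W + L - b else L - b"
    let ?s1 = "?s(TOT := binary ?d, CRY := [L < b])"
    let ?s2 = "?s(TOT := binary ?d)"
    have 1: "runs (sub TOT THR) ?s (27 * W + 6) ?s1"
      using s W ready
      by (intro runs_mono[OF runs_sub[where a = L and b = b and W = W]])
        (auto simp: arith_regs_def arith_ready_def)
    have "\<exists>s'. runs (if L < b then sub NEG TOT ;; announce True NEG else announce False TOT) ?s2
        ((27 * W + 6) + (9 * W + 4)) s' \<and> s' IO = decision_code (int L - B) (s IO)"
    proof (cases "L < b")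
      case True
      let ?s3 = "?s2(NEG := binary (b - L), CRY := [True])"
      let ?s4 = "?s3(NEG := [], IO := True # delimited (binary (b - L)) @ s IO)"
      have d: "0 < ?d" "?d < 2 ^ W" "2 ^ W + 0 - ?d = b - L"
        using True W by auto
      have 3: "runs (sub NEG TOT) ?s2 (27 * W + 6) ?s3"
        using s W ready d
        by (intro runs_mono[OF runs_sub[where a = 0 and b = ?d and W = W]])
          (auto simp: arith_regs_def arith_ready_def)
      have 4: "runs (announce True NEG) ?s3 (9 * W + 4) ?s4"
        using W ready length_binary_le[of "b - L" W] by (intro runs_mono[OF runs_announce]) auto
      have "nat \<bar>int L - B\<bar> = b - L" "int L - B < 0"
        using True False by (auto simp: b_def)
      with runs_Seq[OF 3 4] show ?thesis
        using True by (intro exI[of _ ?s4]) (simp add: decision_code_def)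
    next
      case no_borrow: False
      let ?s4 = "?s2(TOT := [], IO := False # delimited (binary (L - b)) @ s IO)"
      have len: "length (binary (L - b)) \<le> W"
        using W by (intro length_binary_le) linarith
      have "runs (announce False TOT) ?s2 ((27 * W + 6) + (9 * W + 4)) ?s4"
        using W ready len no_borrow by (intro runs_mono[OF runs_announce]) auto
      moreover have "nat \<bar>int L - B\<bar> = L - b" "\<not> int L - B < 0"
        using no_borrow False by (auto simp: b_def)
      ultimately show ?thesis
        using no_borrow by (intro exI[of _ ?s4]) (simp add: decision_code_def)
    qed
    then obtain s' where s': "runs (if L < b then sub NEG TOT ;; announce True NEG else announce False TOT)
        ?s2 ((27 * W + 6) + (9 * W + 4)) s'" "s' IO = decision_code (int L - B) (s IO)"
      by blast
    have "?s1(CRY := []) = ?s2"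
      using ready by (auto simp: fun_eq_iff)
    then have 2: "runs (pop_bit CRY (\<lambda>c. if c then sub NEG TOT ;; announce True NEG
        else announce False TOT)) ?s1 (((27 * W + 6) + (9 * W + 4)) + 2) s'"
      using s'(1) by (intro runs_pop_bit) simp
    have "runs (?c (B < 0)) ?s (63 * W + 18) s'"
      using False runs_mono[OF runs_Seq[OF 1 2], of "63 * W + 18"] by simp
    then show ?thesis
      using s'(2) by blast
  qed
  then obtain s' where "runs (?c (B < 0)) ?s (63 * W + 18) s'" "s' IO = decision_code (int L - B) (s IO)"
    by blast
  then show ?thesis
    unfolding complement_threshold_def using s
    by (intro exI[of _ s'] conjI runs_mono[OF runs_pop_bit[where t = "63 * W + 18"]]) auto
qed

text \<open>
  An infeasible domination instance is mapped to the threshold \<open>L + 1\<close>, which no packing reaches: the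
  threshold \<open>B\<close> is overwritten by \<open>- 1\<close>.
\<close>

definition override_threshold :: "bool \<Rightarrow> prog" where
  "override_threshold strict = pop_bit BAD (\<lambda>b. if strict \<and> b
     then Pop SGN ;; Push SGN True ;; clear THR ;; Push THR True else Skip)"

lemma runs_override_threshold:
  assumes "s SGN = [B < 0]" "s THR = binary (nat \<bar>B\<bar>)" "length (s THR) \<le> W"
    and B': "B' = (if strict \<and> top_bit (s BAD) then - 1 else B)"
  shows "runs (override_threshold strict) s (4 * W + 6)
    (s(BAD := tl (s BAD), SGN := [B' < 0], THR := binary (nat \<bar>B'\<bar>)))"
proof -
  let ?s = "s(BAD := tl (s BAD))"
  let ?t = "?s(SGN := [B' < 0], THR := binary (nat \<bar>B'\<bar>))"
  have "runs (if strict \<and> top_bit (s BAD) then Pop SGN ;; Push SGN True ;; clear THR ;; Push THR True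
      else Skip) ?s (4 * W + 4) ?t"
  proof (cases "strict \<and> top_bit (s BAD)")
    case True
    have 1: "runs (Pop SGN) ?s 1 (?s(SGN := []))"
      using assms by (intro runs_mono[OF runs_Pop]) auto
    have 2: "runs (Push SGN True) (?s(SGN := [])) 1 (?s(SGN := [True]))"
      by (intro runs_mono[OF runs_Push]) auto
    have 3: "runs (clear THR) (?s(SGN := [True])) (4 * W + 1) (?s(SGN := [True], THR := []))"
      using assms by (intro runs_mono[OF runs_clear]) auto
    have 4: "runs (Push THR True) (?s(SGN := [True], THR := [])) 1 ?t"
      using True B' by (intro runs_mono[OF runs_Push]) auto
    have "runs (Pop SGN ;; Push SGN True ;; clear THR ;; Push THR True) ?s (4 * W + 4) ?t"
      by (rule runs_mono[OF runs_Seq[OF 1 runs_Seq[OF 2 runs_Seq[OF 3 4]]]]) auto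
    with True show ?thesis
      by simp
  next
    case False
    then show ?thesis
      using assms by (auto intro!: runs_mono[OF runs_Skip] simp: fun_eq_iff)
  qed
  then show ?thesis
    unfolding override_threshold_def
    by (intro runs_mono[OF runs_pop_bit[where t = "4 * W + 4"]]) auto
qed

section \<open>Reduction programs for the decision and the optimization version\<close>

definition reduce_prog :: "bool \<Rightarrow> prog" where
  "reduce_prog strict = duplicate IO CLK ;; pop_bit IO (Push SGN) ;; receive IO THR ;;
     complement_prog ;; override_threshold strict ;; complement_threshold"

definition has_infeasible :: "nat \<Rightarrow> vertex list \<Rightarrow> bool" where
  "has_infeasible ell V \<longleftrightarrow> (\<exists>v \<in> set V. infeasible ell (labels V) v)"

text \<open>\<open>BAD\<close> contains only 1s, so its top bit tells whether it is
  nonempty.\<close>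

lemma top_bit_infeasible:
  "top_bit (map (\<lambda>_. True) (rev (filter (infeasible ell (labels V)) V))) \<longleftrightarrow> has_infeasible ell V"
proof (cases "filter (infeasible ell (labels V)) V" rule: rev_cases)
  case Nil
  then show ?thesis
    by (auto simp: has_infeasible_def filter_empty_conv)
next
  case (snoc ys y)
  then have "y \<in> set (filter (infeasible ell (labels V)) V)"
    by simp
  then have "y \<in> set V" "infeasible ell (labels V) y"
    by (simp_all only: set_filter mem_Collect_eq)
  then show ?thesis
    using snoc by (auto simp: has_infeasible_def)
qed

lemma runs_reduce_prog:
  assumes s: "s IO = decision_code B (instance_bits ell V)" "\<forall>r \<in> {INP..NEG}. s r = []"
    and wf: "well_formed V"
    and W: "W = length (s IO)"
    and B': "B' = (if strict \<and> has_infeasible ell V then - 1 else B)"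
  shows "\<exists>s'. runs (reduce_prog strict) s (2000 * (W + 1) ^ 3) s' \<and>
    s' IO = decision_code (int (free_total ell V) - B') (complement_bits ell V)"
proof -
  define b where "b = nat \<bar>B\<bar>"
  let ?i = "instance_bits ell V" and ?L = "free_total ell V"
  let ?bad = "map (\<lambda>_. True) (rev (filter (infeasible ell (labels V)) V))"
  have empty: "s INP = []" "s CLK = []" "s TMP = []" "s ELL = []" "s LAB = []" "s SEEN = []" "s ACC = []"
      "s DEM = []" "s ROW = []" "s TOT = []" "s OUT = []" "s VLOOP = []" "s DLOOP = []"
      "s CRY = []" "s RES = []" "s SAV = []" "s BAD = []" "s SGN = []" "s THR = []" "s NEG = []"
    using s(2) by auto
  have io: "s IO = (B < 0) # delimited (binary b) @ ?i"
    using s(1) by (simp add: decision_code_def b_def)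
  then have len: "W = 2 * length (binary b) + 2 + length ?i"
    using W by simp
  let ?s1 = "s(CLK := s IO)"
  let ?s2 = "?s1(SGN := [B < 0], IO := delimited (binary b) @ ?i)"
  let ?s3 = "?s2(IO := ?i, THR := binary b)"
  let ?s4 = "?s3(IO := complement_bits ell V, ELL := binary ell, LAB := labels V,
       TOT := binary ?L, BAD := ?bad)"
  let ?s5 = "?s4(BAD := tl ?bad, SGN := [B' < 0], THR := binary (nat \<bar>B'\<bar>))"
  have 1: "runs (duplicate IO CLK) s (9 * W + 2) ?s1"
    using W empty by (intro runs_mono[OF runs_duplicate]) auto
  have 2: "runs (pop_bit IO (Push SGN)) ?s1 (1 + 2) ?s2"
    using io empty by (intro runs_pop_bit runs_mono[OF runs_Push]) (auto simp: fun_eq_iff)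
  have 3: "runs (receive IO THR) ?s2 (10 * W + 7) ?s3"
    using empty len by (intro runs_mono[OF runs_receive[where xs = "binary b" and us = ?i]]) auto
  have 4: "runs complement_prog ?s3 (1000 * (W + 1) ^ 3) ?s4"
  proof (intro runs_mono[OF runs_complement_prog[where ell = ell and V = V and W = W]])
    show "\<forall>r \<in> {INP..BAD} - {CLK}. ?s3 r = []"
      using s(2) by auto
  qed (use wf W len in \<open>auto simp: fun_eq_iff\<close>)
  have 5: "runs (override_threshold strict) ?s4 (4 * W + 6) ?s5"
    using len B' empty
    by (intro runs_mono[OF runs_override_threshold[where B = B and B' = B' and W = W]])
      (auto simp: b_def top_bit_infeasible)
  \<comment> \<open>The clock is the whole decision code, whose sign and delimiter leave at least
    one bit to spare: both summands are bounded by \<open>2 ^ (W - 1)\<close>, the first one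
    strictly. This includes the magnitude 1 of an overridden threshold.\<close>
  have "?L + nat \<bar>B'\<bar> < 2 ^ W"
  proof -
    have "?L \<le> ell * length V"
      by (rule free_total_le)
    also have "\<dots> < 2 ^ length ?i"
      using instance_bits_bounds(3)[of ell V, OF order_refl] by (simp add: algebra_simps)
    also have "\<dots> \<le> 2 ^ (W - 1)"
      using len by (intro power_increasing) auto
    finally have L: "?L < 2 ^ (W - 1)" .
    have "b < 2 ^ length (binary b)"
      by (rule less_power_length_binary)
    also have "\<dots> \<le> 2 ^ (W - 1)"
      using len by (intro power_increasing) auto
    finally have "b < 2 ^ (W - 1)" .
    moreover have "(1 :: nat) \<le> 2 ^ (W - 1)"
      by simp
    ultimately have "nat \<bar>B'\<bar> \<le> 2 ^ (W - 1)"
      unfolding B' b_def by auto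
    from add_less_le_mono[OF L this] have "?L + nat \<bar>B'\<bar> < 2 * 2 ^ (W - 1)"
      by (simp only: mult_2)
    also have "\<dots> = 2 ^ W"
      using len by (simp flip: power_Suc)
    finally show ?thesis .
  qed
  then obtain s' where 6: "runs complement_threshold ?s5 (63 * W + 20) s'"
    and s': "s' IO = decision_code (int ?L - B') (?s5 IO)"
    using runs_complement_threshold[of ?s5 ?L B' W] empty W by (auto simp: arith_ready_def)
  have time: "(9 * W + 2) + ((1 + 2) + ((10 * W + 7) + (1000 * (W + 1) ^ 3 + ((4 * W + 6) + (63 * W + 20)))))
      \<le> 2000 * (W + 1) ^ 3"
    by (simp add: power3_eq_cube algebra_simps)
  have "runs (reduce_prog strict) s (2000 * (W + 1) ^ 3) s'"
    unfolding reduce_prog_def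
    by (rule runs_mono[OF runs_Seq[OF 1 runs_Seq[OF 2 runs_Seq[OF 3 runs_Seq[OF 4 runs_Seq[OF 5 6]]]]] time])
      simp
  then show ?thesis
    using s' by auto
qed

definition prepare_prog :: prog where
  "prepare_prog = duplicate IO CLK ;; complement_prog"

lemma runs_prepare_prog:
  assumes s: "s IO = instance_bits ell V" "\<forall>r \<in> {INP..BAD}. s r = []"
    and wf: "well_formed V"
    and W: "W = length (s IO)"
  shows "runs prepare_prog s (2000 * (W + 1) ^ 3)
    (s(CLK := instance_bits ell V, IO := complement_bits ell V, ELL := binary ell, LAB := labels V,
       TOT := binary (free_total ell V),
       BAD := map (\<lambda>_. True) (rev (filter (infeasible ell (labels V)) V))))"
proof -
  let ?s1 = "s(CLK := s IO)"
  have 1: "runs (duplicate IO CLK) s (9 * W + 2) ?s1"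
    using W s by (intro runs_mono[OF runs_duplicate]) auto
  have 2: "runs complement_prog ?s1 (1000 * (W + 1) ^ 3)
    (?s1(IO := complement_bits ell V, ELL := binary ell, LAB := labels V,
       TOT := binary (free_total ell V),
       BAD := map (\<lambda>_. True) (rev (filter (infeasible ell (labels V)) V))))"
    using s W wf by (intro runs_complement_prog) auto
  have time: "(9 * W + 2) + 1000 * (W + 1) ^ 3 \<le> 2000 * (W + 1) ^ 3"
    by (simp add: power3_eq_cube algebra_simps)
  show ?thesis
    unfolding prepare_prog_def
    by (rule runs_mono[OF runs_Seq[OF 1 2] time]) (use s in \<open>auto simp: fun_eq_iff\<close>)
qed

text \<open>Complemented instances are always feasible, so the solver leaves the code of some value
  and its leading 1 can be popped unseen; only \<open>BAD\<close> decides about the empty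
  answer.\<close>

definition finish_prog :: "bool \<Rightarrow> prog" where
  "finish_prog strict = pop_bit BAD (\<lambda>b. if strict \<and> b then clear IO
     else Pop IO ;; sub TOT IO ;; clear IO ;; move TOT TMP ;; move TMP IO ;; Push IO True)"

lemma runs_finish_prog:
  assumes s: "s IO = answer (Some m)" "s TOT = binary L" "arith_ready s"
    and W: "length (s CLK) = W" "m \<le> L" "L < 2 ^ W"
  shows "\<exists>s'. runs (finish_prog strict) s (39 * W + 13) s' \<and>
    s' IO = (if strict \<and> top_bit (s BAD) then [] else answer (Some (L - m)))"
proof -
  let ?s = "s(BAD := tl (s BAD))"
  have ready: "s TMP = []" "s CRY = []" "s RES = []" "s SAV = []"
    using s(3) by (auto simp: arith_ready_def)
  have len: "length (binary m) \<le> W" "length (binary (L - m)) \<le> W"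
    using W by (auto intro!: length_binary_le)
  have "\<exists>s'. runs (if strict \<and> top_bit (s BAD) then clear IO
     else Pop IO ;; sub TOT IO ;; clear IO ;; move TOT TMP ;; move TMP IO ;; Push IO True)
     ?s (39 * W + 11) s' \<and>
     s' IO = (if strict \<and> top_bit (s BAD) then [] else answer (Some (L - m)))"
  proof (cases "strict \<and> top_bit (s BAD)")
    case True
    have "runs (clear IO) ?s (39 * W + 11) (?s(IO := []))"
      using s len by (intro runs_mono[OF runs_clear]) auto
    then show ?thesis
      using True by (intro exI[of _ "?s(IO := [])"]) simp
  next
    case False
    let ?s1 = "?s(IO := binary m)"
    let ?s2 = "?s1(TOT := binary (L - m), CRY := [False])"
    let ?s3 = "?s2(IO := [])"
    let ?s4 = "?s3(TOT := [], TMP := rev (binary (L - m)))"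
    let ?s5 = "?s4(TMP := [], IO := binary (L - m))"
    let ?s6 = "?s5(IO := True # binary (L - m))"
    have 1: "runs (Pop IO) ?s 1 ?s1"
      using s by (intro runs_mono[OF runs_Pop]) auto
    have 2: "runs (sub TOT IO) ?s1 (27 * W + 6) ?s2"
      using s W ready
      by (intro runs_mono[OF runs_sub[where a = L and b = m and W = W]])
        (auto simp: arith_regs_def arith_ready_def)
    have 3: "runs (clear IO) ?s2 (4 * W + 1) ?s3"
      using len by (intro runs_mono[OF runs_clear]) auto
    have 4: "runs (move TOT TMP) ?s3 (4 * W + 1) ?s4"
      using len ready by (intro runs_mono[OF runs_move]) auto
    have 5: "runs (move TMP IO) ?s4 (4 * W + 1) ?s5"
      using len by (intro runs_mono[OF runs_move]) auto
    have 6: "runs (Push IO True) ?s5 1 ?s6"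
      by (intro runs_mono[OF runs_Push]) auto
    have "runs (Pop IO ;; sub TOT IO ;; clear IO ;; move TOT TMP ;; move TMP IO ;; Push IO True)
        ?s (39 * W + 11) ?s6"
      by (rule runs_mono[OF runs_Seq[OF 1 runs_Seq[OF 2 runs_Seq[OF 3 runs_Seq[OF 4 runs_Seq[OF 5 6]]]]]])
        auto
    then show ?thesis
      using False by (intro exI[of _ ?s6]) auto
  qed
  then obtain s' where "runs (if strict \<and> top_bit (s BAD) then clear IO
     else Pop IO ;; sub TOT IO ;; clear IO ;; move TOT TMP ;; move TMP IO ;; Push IO True)
     ?s (39 * W + 11) s'"
    and "s' IO = (if strict \<and> top_bit (s BAD) then [] else answer (Some (L - m)))"
    by blast
  then show ?thesis
    unfolding finish_prog_def
    by (intro exI[of _ s'] conjI runs_mono[OF runs_pop_bit[where t = "39 * W + 11"]]) simp_all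
qed

section \<open>Complementary labelled functions\<close>

definition room :: "'a instnc \<Rightarrow> 'a \<Rightarrow> nat" where
  "room I v = bound I * card {u \<in> closed_nbhd (graph I) v. label I u = Free}"

definition budget :: "'a instnc \<Rightarrow> nat" where
  "budget I = bound I * card {v \<in> verts (graph I). label I v = Free}"

definition complement :: "'a instnc \<Rightarrow> 'a instnc" where
  "complement I = I\<lparr>demand := \<lambda>v. room I v - demand I v\<rparr>"

definition flip :: "'a instnc \<Rightarrow> ('a \<Rightarrow> nat) \<Rightarrow> 'a \<Rightarrow> nat" where
  "flip I f = (\<lambda>v \<in> verts (graph I). if label I v = Free then bound I - f v else 0)"

lemma complement_simps [simp]:
  "graph (complement I) = graph I" "bound (complement I) = bound I"
  "label (complement I) = label I" "demand (complement I) v = room I v - demand I v"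
  by (simp_all add: complement_def)

lemma labelled_function_complement [simp]: "labelled_function (complement I) = labelled_function I"
  by (simp add: labelled_function_def fun_eq_iff)

lemma labelled_function_flip: "labelled_function I (flip I f)"
  by (auto simp: labelled_function_def flip_def)

text \<open>Pointwise the two values add up to the bound on free vertices and to 0 elsewhere. The
  additive form avoids truncation and serves neighbourhoods as well as the whole vertex set.\<close>

lemma sum_flip:
  assumes "labelled_function I f" "A \<subseteq> verts (graph I)" "finite A"
  shows "sum f A + sum (flip I f) A = bound I * card {v \<in> A. label I v = Free}"
proof -
  have "f v + flip I f v = (if label I v = Free then bound I else 0)" if "v \<in> A" for v
  proof -
    have "v \<in> verts (graph I)"
      using that assms by auto
    then have "f v \<le> bound I" "label I v = Zero \<longrightarrow> f v = 0"
      using assms(1) by (auto simp: labelled_function_def PiE_iff)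
    then show ?thesis
      using \<open>v \<in> verts (graph I)\<close> by (cases "label I v") (auto simp: flip_def)
  qed
  then have "sum f A + sum (flip I f) A = (\<Sum>v\<in>A. if label I v = Free then bound I else 0)"
    unfolding sum.distrib[symmetric] by (rule sum.cong[OF refl])
  also have "\<dots> = (\<Sum>v | v \<in> A \<and> label I v = Free. bound I)"
    using assms(3) by (rule sum.inter_filter[symmetric])
  finally show ?thesis
    by simp
qed

lemma closed_nbhd_subset: "v \<in> verts G \<Longrightarrow> closed_nbhd G v \<subseteq> verts G"
  by (auto simp: closed_nbhd_def)

context
  fixes I :: "'a instnc"
  assumes graph: "simple_graph (graph I)"
begin

lemma sum_flip_nbhd:
  assumes "labelled_function I f" "v \<in> verts (graph I)"
  shows "sum f (closed_nbhd (graph I) v) + sum (flip I f) (closed_nbhd (graph I) v) = room I v"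
  unfolding room_def
  using assms graph closed_nbhd_subset[OF assms(2)]
  by (intro sum_flip) (auto simp: simple_graph_def intro: finite_subset)

lemma sum_flip_verts:
  "labelled_function I f \<Longrightarrow> sum f (verts (graph I)) + sum (flip I f) (verts (graph I)) = budget I"
  unfolding budget_def using graph by (intro sum_flip) (auto simp: simple_graph_def)

lemma dominating_flip_packing: "packing_function I f \<Longrightarrow> dominating_function (complement I) (flip I f)"
  by (force simp: packing_function_def dominating_function_def labelled_function_flip
      dest: sum_flip_nbhd[of f])

lemma packing_flip_dominating: "dominating_function (complement I) f \<Longrightarrow> packing_function I (flip I f)"
  by (force simp: packing_function_def dominating_function_def labelled_function_flip
      dest: sum_flip_nbhd[of f])

lemma packing_flip_dominating':
  "dominating_function I f \<Longrightarrow> packing_function (complement I) (flip I f)"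
  by (force simp: packing_function_def dominating_function_def labelled_function_flip
      dest: sum_flip_nbhd[of f])

text \<open>The only one of the four transfers with a condition on demands: where
  \<open>demand I v\<close> exceeds \<open>room I v\<close>, truncation to 0 forgets how much is
  missing.\<close>

lemma dominating_flip_packing':
  "packing_function (complement I) f \<Longrightarrow> \<forall>v \<in> verts (graph I). demand I v \<le> room I v
    \<Longrightarrow> dominating_function I (flip I f)"
  by (force simp: packing_function_def dominating_function_def labelled_function_flip
      dest: sum_flip_nbhd[of f])

lemma demand_le_room:
  assumes "dominating_function I f" "v \<in> verts (graph I)"
  shows "demand I v \<le> room I v"
  using assms sum_flip_nbhd[of f v] by (auto simp: dominating_function_def)

end

section \<open>Mirrored sets of objective values\<close>

definition mirrored :: "nat \<Rightarrow> nat set \<Rightarrow> nat set \<Rightarrow> bool" where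
  "mirrored L A B \<longleftrightarrow> A \<subseteq> {..L} \<and> B = (\<lambda>m. L - m) ` A"

text \<open>Each direction of \<open>flip\<close> supplies one inclusion, with the values related by
  \<open>sum_flip_verts\<close>, so feasibility only has to be transferred as an implication both
  ways.\<close>

lemma mirrored_objectives:
  fixes P Q :: "('a \<Rightarrow> nat) \<Rightarrow> bool"
  assumes "simple_graph (graph I)"
    and "\<And>f. P f \<Longrightarrow> labelled_function I f" "\<And>f. Q f \<Longrightarrow> labelled_function I f"
    and "\<And>f. P f \<Longrightarrow> Q (flip I f)" "\<And>f. Q f \<Longrightarrow> P (flip I f)"
  shows "mirrored (budget I) {sum f (verts (graph I)) | f. P f} {sum f (verts (graph I)) | f. Q f}"
proof -
  let ?V = "verts (graph I)"
  have *: "sum f ?V \<le> budget I" "sum (flip I f) ?V = budget I - sum f ?V"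
    "sum f ?V = budget I - sum (flip I f) ?V" if "labelled_function I f" for f
    using sum_flip_verts[OF assms(1) that] by auto
  show ?thesis
    unfolding mirrored_def
  proof (intro conjI subsetI equalityI)
    fix m
    assume "m \<in> {sum f ?V | f. P f}"
    then show "m \<in> {..budget I}"
      using *(1) assms(2) by auto
  next
    fix m
    assume "m \<in> {sum f ?V | f. Q f}"
    then obtain f where f: "m = sum f ?V" "Q f"
      by blast
    then have "P (flip I f)" "m = budget I - sum (flip I f) ?V"
      using assms(5) *(3)[OF assms(3)] by simp_all
    then show "m \<in> (\<lambda>m. budget I - m) ` {sum f ?V | f. P f}"
      by blast
  next
    fix m
    assume "m \<in> (\<lambda>m. budget I - m) ` {sum f ?V | f. P f}"
    then obtain f where f: "m = budget I - sum f ?V" "P f"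
      by blast
    then have "Q (flip I f)" "m = sum (flip I f) ?V"
      using assms(4) *(2)[OF assms(2)] by simp_all
    then show "m \<in> {sum f ?V | f. Q f}"
      by blast
  qed
qed

text \<open>The inclusion in \<open>{..L}\<close> makes the truncated difference
  \<open>L - m\<close> an involution.\<close>

lemma mirrored_swap:
  assumes "mirrored L A B"
  shows "mirrored L B A"
proof -
  have "(\<lambda>m. L - m) ` (\<lambda>m. L - m) ` A = A"
    using assms by (subst image_image, subst image_cong[where g = id]) (auto simp: mirrored_def)
  then show ?thesis
    using assms by (auto simp: mirrored_def)
qed

lemma Max_mirrored:
  assumes "mirrored L A B" "A \<noteq> {}"
  shows "Max B \<le> L" "Min A = L - Max B"
proof -
  have AB: "A \<subseteq> {..L}" "B = (\<lambda>m. L - m) ` A"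
    using assms(1) by (auto simp: mirrored_def)
  have fin: "finite A" "finite B"
    using AB finite_subset by auto
  have "Min A \<in> A"
    using fin assms by simp
  have "Max B = L - Min A"
  proof (rule Max_eqI)
    show "L - Min A \<in> B"
      using AB \<open>Min A \<in> A\<close> by auto
    show "y \<le> L - Min A" if "y \<in> B" for y
      using that fin AB by (auto intro!: diff_le_mono2)
  qed (use fin in auto)
  then show "Max B \<le> L" "Min A = L - Max B"
    using AB \<open>Min A \<in> A\<close> by auto
qed

lemma Min_mirrored:
  assumes "mirrored L A B" "A \<noteq> {}"
  shows "Min B \<le> L" "Max A = L - Min B"
proof -
  have "B \<noteq> {}"
    using assms by (auto simp: mirrored_def)
  note * = Max_mirrored[OF mirrored_swap[OF assms(1)] this]
  then show "Min B \<le> L" "Max A = L - Min B"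
    by auto
qed

lemma opt_mirrored:
  assumes "mirrored L (objective P i) (objective Q j)" "goal P \<noteq> goal Q" "objective Q j \<noteq> {}"
  obtains m where "opt Q j = Some m" "m \<le> L" "opt P i = Some (L - m)"
proof -
  have ne: "objective P i \<noteq> {}"
    using assms by (auto simp: mirrored_def)
  show ?thesis
  proof (cases "goal Q")
    case Minimize
    then have "goal P = Maximize"
      using assms(2) by (cases "goal P") auto
    then show ?thesis
      using that[of "Min (objective Q j)"] Minimize assms ne Min_mirrored[OF assms(1) ne]
      by (simp add: opt_def)
  next
    case Maximize
    then have "goal P = Minimize"
      using assms(2) by (cases "goal P") auto
    then show ?thesis
      using that[of "Max (objective Q j)"] Maximize assms ne Max_mirrored[OF assms(1) ne]
      by (simp add: opt_def)
  qed
qed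

text \<open>The reflected threshold is an integer and never truncated, so values of \<open>B\<close>
  below 0 or above \<open>L\<close> are covered; the opposite goals absorb the reversal of the
  inequality.\<close>

lemma reaches_mirrored:
  assumes "mirrored L (objective P i) (objective Q j)" "goal P \<noteq> goal Q"
  shows "reaches Q j (int L - B) \<longleftrightarrow> reaches P i B"
proof -
  have *: "m \<le> L" if "m \<in> objective P i" for m
    using assms(1) that by (auto simp: mirrored_def)
  have "reaches Q j (int L - B) \<longleftrightarrow> (\<exists>m \<in> objective P i.
      case goal Q of Minimize \<Rightarrow> int (L - m) \<le> int L - B | Maximize \<Rightarrow> int (L - m) \<ge> int L - B)"
    using assms(1) by (auto simp: reaches_def mirrored_def)
  also have "\<dots> \<longleftrightarrow> reaches P i B"
    unfolding reaches_def using assms(2) *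
    by (cases "goal P"; cases "goal Q") force+
  finally show ?thesis .
qed

section \<open>Instances as bit strings\<close>

definition vertices :: "'a instnc \<Rightarrow> 'a list \<Rightarrow> vertex list" where
  "vertices I vs = map (\<lambda>v. (label I v = Free, demand I v, map (\<lambda>u. {u, v} \<in> edges (graph I)) vs)) vs"

lemma well_formed_vertices: "well_formed (vertices I vs)"
  by (auto simp: well_formed_def vertices_def)

lemma labels_vertices: "labels (vertices I vs) = map (\<lambda>v. label I v = Free) vs"
  by (simp add: labels_def vertices_def comp_def)

lemma instnc_code_eq: "instnc_code I vs = instance_bits (bound I) (vertices I vs)"
  by (simp add: instnc_code_def instance_bits_def vertices_def vertex_code_def comp_def)

lemma hits_map: "hits (map f vs) (map g vs) = length (filter (\<lambda>v. f v \<and> g v) vs)"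
  by (induction vs) (auto simp: hits_def)

context
  fixes I :: "'a instnc" and vs :: "'a list"
  assumes graph: "simple_graph (graph I)" and vs: "distinct vs" "set vs = verts (graph I)"
begin

lemma capacity_vertices:
  assumes "v \<in> verts (graph I)"
  shows "capacity (bound I) (labels (vertices I vs))
    (label I v = Free, k, map (\<lambda>u. {u, v} \<in> edges (graph I)) vs) = room I v"
proof -
  define A where "A = {u \<in> verts (graph I). {u, v} \<in> edges (graph I) \<and> label I u = Free}"
  \<comment> \<open>The row entry of \<open>v\<close> at itself asks for the edge
    \<open>{v, v} = {v}\<close>, which has the wrong cardinality; hence \<open>v\<close> is not
    counted twice.\<close>
  have loop: "{v} \<notin> edges (graph I)"
    using graph by (auto simp: simple_graph_def)
  have "{u \<in> closed_nbhd (graph I) v. label I u = Free} = (if label I v = Free then insert v A else A)"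
    using assms by (auto simp: closed_nbhd_def A_def)
  moreover have "finite A" "v \<notin> A"
    using graph loop by (auto simp: simple_graph_def A_def)
  ultimately have "card {u \<in> closed_nbhd (graph I) v. label I u = Free} = of_bool (label I v = Free) + card A"
    by simp
  moreover have "hits (map (\<lambda>u. {u, v} \<in> edges (graph I)) vs) (labels (vertices I vs)) = card A"
    unfolding labels_vertices hits_map distinct_length_filter[OF vs(1)] vs(2) A_def
    by (rule arg_cong[where f = card]) auto
  ultimately show ?thesis
    by (simp add: room_def)
qed

lemma free_total_vertices: "free_total (bound I) (vertices I vs) = budget I"
proof -
  have "length (filter id (labels (vertices I vs))) = card {v \<in> verts (graph I). label I v = Free}"
    unfolding labels_vertices filter_map length_map distinct_length_filter[OF vs(1)] vs(2)
    by (rule arg_cong[where f = card]) auto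
  then show ?thesis
    by (simp add: free_total_def budget_def)
qed

lemma complement_bits_vertices:
  "complement_bits (bound I) (vertices I vs) = instnc_code (complement I) vs"
proof -
  let ?row = "\<lambda>v. map (\<lambda>u. {u, v} \<in> edges (graph I)) vs"
  have "map g (vertices I vs) = vertices (complement I) vs"
    if "\<And>v. v \<in> set vs \<Longrightarrow> g (label I v = Free, demand I v, ?row v) =
      (label I v = Free, room I v - demand I v, ?row v)" for g
    using that by (simp add: vertices_def)
  then have "map (complement_vertex (bound I) (labels (vertices I vs))) (vertices I vs) =
      vertices (complement I) vs"
    using vs(2) by (simp add: capacity_vertices del: capacity.simps)
  then show ?thesis
    by (simp add: complement_bits_def instnc_code_eq)
qed

lemma has_infeasible_vertices:
  "has_infeasible (bound I) (vertices I vs) \<longleftrightarrow> (\<exists>v \<in> verts (graph I). room I v < demand I v)"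
proof -
  have "has_infeasible (bound I) (vertices I vs) \<longleftrightarrow> (\<exists>v \<in> set vs. infeasible (bound I)
      (labels (vertices I vs)) (label I v = Free, demand I v, map (\<lambda>u. {u, v} \<in> edges (graph I)) vs))"
    unfolding has_infeasible_def vertices_def[of I vs] set_map by (simp flip: vertices_def)
  then show ?thesis
    using vs(2) by (simp add: capacity_vertices del: capacity.simps)
qed

end

section \<open>Transfer of complexity\<close>

definition result :: "prog \<Rightarrow> regs \<Rightarrow> regs" where
  "result c s = (THE s'. \<exists>n. exec c s n s')"

lemma result_eq: "runs c s t s' \<Longrightarrow> result c s = s'"
  unfolding result_def runs_def by (blast intro: exec_deterministic)

lemma polytime_on_result:
  assumes "\<And>xs. xs \<in> D \<Longrightarrow> \<exists>s. runs c (init_regs xs) (poly p (sum_list (map length xs))) s"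
  shows "polytime_on D (\<lambda>xs. result c (init_regs xs) 0)"
  unfolding polytime_on_def
proof (intro exI[of _ c] exI[of _ p] ballI)
  fix xs
  assume "xs \<in> D"
  then obtain s where s: "runs c (init_regs xs) (poly p (sum_list (map length xs))) s"
    using assms by blast
  from s obtain n where "n \<le> poly p (sum_list (map length xs))" "exec c (init_regs xs) n s"
    by (auto simp: runs_def)
  then show "\<exists>n s. exec c (init_regs xs) n s \<and> s 0 = result c (init_regs xs) 0 \<and>
      n \<le> poly p (sum_list (map length xs))"
    using result_eq[OF s] by blast
qed

lemma poly_mono_nat: "m \<le> n \<Longrightarrow> poly (p :: nat poly) m \<le> poly p n"
  by (induction p) (auto intro!: add_mono mult_mono)

text \<open>Moving all registers of a program but 0 out of the way makes room for the registers of the programs above.\<close>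

definition shift_reg :: "nat \<Rightarrow> nat" where
  "shift_reg r = (if r = 0 then 0 else r + NEG)"

lemma inj_shift_reg: "inj shift_reg"
  by (auto simp: inj_def shift_reg_def split: if_splits)

lemma shift_reg_range: "r \<in> {INP..NEG} \<Longrightarrow> r \<notin> range shift_reg"
  by (auto simp: shift_reg_def)

text \<open>Register 0 is shared because it carries input and output of the black box. The latter
  has all registers above \<open>NEG\<close> at its disposal, while those from 1 to
  \<open>NEG\<close> keep intermediate results.\<close>

lemma runs_shifted:
  assumes "exec c (init_regs [x]) n s" "t 0 = x" "\<And>r. r > NEG \<Longrightarrow> t r = []"
  obtains t' where "exec (rename_regs shift_reg c) t n t'" "t' 0 = s 0"
    "\<And>r. r \<in> {INP..NEG} \<Longrightarrow> t' r = t r"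
proof -
  have "t \<circ> shift_reg = init_regs [x]"
    using assms(2,3) by (auto simp: fun_eq_iff shift_reg_def init_regs_def)
  from exec_rename_regs[OF assms(1) inj_shift_reg this] obtain t'
    where t': "exec (rename_regs shift_reg c) t n t'" "t' \<circ> shift_reg = s"
      "\<forall>r. r \<notin> range shift_reg \<longrightarrow> t' r = t r"
    by blast
  have "t' 0 = s 0"
    using t'(2) by (auto simp: fun_eq_iff shift_reg_def dest: spec[of _ 0])
  then show ?thesis
    using that t' shift_reg_range by blast
qed

lemma runs_exec: "exec c s n s' \<Longrightarrow> n \<le> t \<Longrightarrow> runs c s t s'"
  by (auto simp: runs_def)

definition blocked :: "'a instnc \<Rightarrow> bool" where
  "blocked I \<longleftrightarrow> (\<exists>v \<in> verts (graph I). room I v < demand I v)"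

text \<open>
  \<open>P\<close> reduces to \<open>Q\<close> by complementing the instances. If \<open>strict\<close> holds (\<open>P\<close> asks for dominating
  functions), blocked instances are infeasible and have to be recognized.
\<close>

definition complementary :: "bool \<Rightarrow> 'a instnc problem \<Rightarrow> 'a instnc problem \<Rightarrow> bool" where
  "complementary strict P Q \<longleftrightarrow> codes P = instnc_codes \<and> codes Q = instnc_codes \<and> goal P \<noteq> goal Q \<and>
     (strict \<longrightarrow> goal Q = Maximize) \<and>
     (\<forall>I \<in> instances P. simple_graph (graph I) \<and> complement I \<in> instances Q \<and>
        objective Q (complement I) \<noteq> {} \<and> objective Q (complement I) \<subseteq> {..budget I} \<and>
        (if strict \<and> blocked I then objective P I = {}
         else mirrored (budget I) (objective P I) (objective Q (complement I))))"

lemma polytime_solvable_complementary: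
  assumes "complementary strict P Q" "polytime_solvable Q"
  shows "polytime_solvable P"
proof -
  let ?D = "{[w] | w i. i \<in> instances Q \<and> w \<in> codes Q i}"
  obtain f where "polytime_on ?D f"
    and f: "\<And>i w. i \<in> instances Q \<Longrightarrow> w \<in> codes Q i \<Longrightarrow> f [w] = answer (opt Q i)"
    using assms(2) unfolding polytime_solvable_def by blast
  then obtain c p where cp: "\<forall>xs\<in>?D. \<exists>n s. exec c (init_regs xs) n s \<and> s 0 = f xs \<and>
      n \<le> poly p (sum_list (map length xs))"
    unfolding polytime_on_def by blast
  have c: "\<exists>n s. exec c (init_regs [w]) n s \<and> s 0 = f [w] \<and> n \<le> poly p (length w)"
    if "i \<in> instances Q" "w \<in> codes Q i" for i w
  proof -
    have "[w] \<in> ?D"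
      using that by blast
    from bspec[OF cp this] show ?thesis
      by simp
  qed
  define d where "d = prepare_prog ;; rename_regs shift_reg c ;; finish_prog strict"
  \<comment> \<open>The solver runs on the complemented instance, so \<open>p\<close> is composed
    with the quadratic bound on its length; the other summands are the costs of
    \<open>prepare_prog\<close> and \<open>finish_prog\<close>.\<close>
  define q where "q = [:2000:] * [:1, 1:] ^ 3 + (pcompose p ([:10:] * [:1, 1:] ^ 2) + [:13, 39:])"
  have poly_q: "poly q n = 2000 * (n + 1) ^ 3 + (poly p (10 * (n + 1) ^ 2) + (39 * n + 13))" for n
    by (simp add: q_def poly_pcompose algebra_simps)
  have d: "\<exists>s. runs d (init_regs [w]) (poly q (length w)) s \<and> s 0 = answer (opt P I)"
    if I: "I \<in> instances P" "w \<in> codes P I" for I w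
  proof -
    note PQ = assms(1)[unfolded complementary_def]
    have graph: "simple_graph (graph I)" and J: "complement I \<in> instances Q"
      and ne: "objective Q (complement I) \<noteq> {}" and le: "objective Q (complement I) \<subseteq> {..budget I}"
      and mir: "if strict \<and> blocked I then objective P I = {}
         else mirrored (budget I) (objective P I) (objective Q (complement I))"
      and goals: "goal P \<noteq> goal Q"
      using PQ I by auto
    obtain vs where vs: "distinct vs" "set vs = verts (graph I)" and w: "w = instnc_code I vs"
      using PQ I by (auto simp: instnc_codes_def)
    let ?V = "vertices I vs" and ?W = "length w" and ?w = "instnc_code (complement I) vs"
    let ?bad = "map (\<lambda>_. True) (rev (filter (infeasible (bound I) (labels ?V)) ?V))"
    have code: "?w \<in> codes Q (complement I)"
      using PQ vs by (auto simp: instnc_codes_def)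
    have w': "w = instance_bits (bound I) ?V"
      by (simp add: w instnc_code_eq)
    let ?s = "(init_regs [w])(CLK := w, IO := ?w, ELL := binary (bound I), LAB := labels ?V,
       TOT := binary (budget I), BAD := ?bad)"
    have prep: "runs prepare_prog (init_regs [w]) (2000 * (?W + 1) ^ 3) ?s"
      using runs_prepare_prog[of "init_regs [w]" "bound I" ?V ?W] well_formed_vertices[of I vs] w'
      by (simp add: init_regs_def complement_bits_vertices[OF graph vs] free_total_vertices[OF graph vs])
    obtain n s where s: "exec c (init_regs [?w]) n s" "s 0 = f [?w]" "n \<le> poly p (length ?w)"
      using c[OF J code] by blast
    obtain t where t: "exec (rename_regs shift_reg c) ?s n t" "t 0 = s 0"
      "\<And>r. r \<in> {INP..NEG} \<Longrightarrow> t r = ?s r"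
      by (rule runs_shifted[OF s(1), of ?s]) (auto simp: init_regs_def)
    have "length ?w \<le> 10 * (?W + 1) ^ 2"
      using length_complement_bits_le[of "bound I" ?V ?W] well_formed_vertices[of I vs] w'
      by (simp add: complement_bits_vertices[OF graph vs])
    then have "n \<le> poly p (10 * (?W + 1) ^ 2)"
      by (rule order_trans[OF s(3) poly_mono_nat])
    with t(1) have run: "runs (rename_regs shift_reg c) ?s (poly p (10 * (?W + 1) ^ 2)) t"
      by (rule runs_exec)
    \<comment> \<open>On a blocked instance the solver is run all the same and its value discarded;
      that a value exists and respects the budget is still required by
      \<open>runs_finish_prog\<close>.\<close>
    obtain m where m: "opt Q (complement I) = Some m" "m \<le> budget I"
      "\<not> (strict \<and> blocked I) \<Longrightarrow> opt P I = Some (budget I - m)"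
    proof (cases "strict \<and> blocked I")
      case True
      have "opt Q (complement I) = Some (Max (objective Q (complement I)))"
        using True PQ ne by (simp add: opt_def)
      moreover have "Max (objective Q (complement I)) \<le> budget I"
        using ne le by (subst Max_le_iff) (auto intro: finite_subset)
      ultimately show ?thesis
        using that True by blast
    next
      case False
      with mir have "mirrored (budget I) (objective P I) (objective Q (complement I))"
        by auto
      then obtain m where "opt Q (complement I) = Some m" "m \<le> budget I" "opt P I = Some (budget I - m)"
        by (rule opt_mirrored[OF _ goals ne])
      then show ?thesis
        using that by blast
    qed
    have "budget I < 2 ^ ?W"
      using free_total_le[of "bound I" ?V] instance_bits_bounds(3)[of "bound I" ?V ?W] w'
      by (simp add: free_total_vertices[OF graph vs])
    moreover have "t 0 = answer (Some m)"
      using t(2) s(2) f[OF J code] m(1) by simp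
    moreover have "t BAD = ?bad" "t TOT = binary (budget I)" "arith_ready t" "t CLK = w"
      using t(3) by (auto simp: arith_ready_def init_regs_def)
    ultimately obtain u where fin: "runs (finish_prog strict) t (39 * ?W + 13) u"
      and u: "u 0 = (if strict \<and> top_bit ?bad then [] else answer (Some (budget I - m)))"
      using runs_finish_prog[of t m "budget I" ?W strict] m(2) by auto
    have "top_bit ?bad \<longleftrightarrow> blocked I"
      unfolding top_bit_infeasible blocked_def by (rule has_infeasible_vertices[OF graph vs])
    then have "u 0 = answer (opt P I)"
      using u m(3) mir by (auto simp: opt_def split: if_splits)
    moreover have "runs d (init_regs [w]) (poly q ?W) u"
      unfolding d_def poly_q by (intro runs_Seq[OF prep] runs_Seq[OF run] fin)
    ultimately show ?thesis
      by blast
  qed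
  show ?thesis
    unfolding polytime_solvable_def
  proof (intro exI conjI ballI)
    show "polytime_on {[w] | w i. i \<in> instances P \<and> w \<in> codes P i} (\<lambda>xs. result d (init_regs xs) 0)"
    proof (rule polytime_on_result[where p = q])
      fix xs
      assume "xs \<in> {[w] | w i. i \<in> instances P \<and> w \<in> codes P i}"
      then obtain w i where xs: "xs = [w]" and "i \<in> instances P" "w \<in> codes P i"
        by blast
      then obtain s where "runs d (init_regs [w]) (poly q (length w)) s"
        using d by blast
      then show "\<exists>s. runs d (init_regs xs) (poly q (sum_list (map length xs))) s"
        using xs by auto
    qed
    show "result d (init_regs [w]) 0 = answer (opt P i)" if "i \<in> instances P" "w \<in> codes P i" for i w
    proof -
      from d[OF that] obtain s where "runs d (init_regs [w]) (poly q (length w)) s"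
        "s 0 = answer (opt P i)"
        by blast
      then show ?thesis
        using result_eq by auto
    qed
  qed
qed

text \<open>Along the same map solvability travels from \<open>Q\<close> to \<open>P\<close> and
  hardness from \<open>P\<close> to \<open>Q\<close>. Here the unknown program is the given
  reduction to \<open>P\<close>; it runs first and its output is the input of
  \<open>reduce_prog\<close>.\<close>

lemma NP_hard_complementary:
  assumes "complementary strict P Q" "NP_hard P"
  shows "NP_hard Q"
  unfolding NP_hard_def
proof (intro allI impI)
  fix L
  assume "in_NP L"
  let ?Y = "\<lambda>P. {decision_code B w | B w i. i \<in> instances P \<and> w \<in> codes P i \<and> reaches P i B}"
  let ?N = "\<lambda>P. {decision_code B w | B w i. i \<in> instances P \<and> w \<in> codes P i \<and> \<not> reaches P i B}"
  have "many_one_reducible L (?Y P) (?N P)"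
    using assms(2) \<open>in_NP L\<close> unfolding NP_hard_def by blast
  then obtain f where "polytime_on {[x] | x. True} f"
    and f: "\<And>x. x \<in> L \<Longrightarrow> f [x] \<in> ?Y P" "\<And>x. x \<notin> L \<Longrightarrow> f [x] \<in> ?N P"
    unfolding many_one_reducible_def by blast
  then obtain c p where cp: "\<forall>xs\<in>{[x] | x. True}. \<exists>n s. exec c (init_regs xs) n s \<and> s 0 = f xs \<and>
      n \<le> poly p (sum_list (map length xs))"
    unfolding polytime_on_def by blast
  have c: "\<exists>n s. exec c (init_regs [x]) n s \<and> s 0 = f [x] \<and> n \<le> poly p (length x)" for x
    using bspec[OF cp, of "[x]"] by simp
  define d where "d = rename_regs shift_reg c ;; reduce_prog strict"
  \<comment> \<open>By \<open>exec_length\<close> the intermediate string is no longer than input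
    length plus running time, and the cubic bound of \<open>reduce_prog\<close> is evaluated
    there.\<close>
  define q where "q = p + [:2000:] * ([:0, 1:] + p + 1) ^ 3"
  have poly_q: "poly q n = poly p n + 2000 * (n + poly p n + 1) ^ 3" for n
    by (simp add: q_def)
  have d: "\<exists>s. runs d (init_regs [x]) (poly q (length x)) s \<and> s 0 \<in> (if x \<in> L then ?Y Q else ?N Q)" for x
  proof -
    note PQ = assms(1)[unfolded complementary_def]
    obtain B w I where x: "f [x] = decision_code B w" and I: "I \<in> instances P" "w \<in> codes P I"
      and reach: "reaches P I B \<longleftrightarrow> x \<in> L"
      using f[of x] by (cases "x \<in> L") auto
    have graph: "simple_graph (graph I)" and J: "complement I \<in> instances Q"
      and le: "objective Q (complement I) \<subseteq> {..budget I}"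
      and mir: "if strict \<and> blocked I then objective P I = {}
         else mirrored (budget I) (objective P I) (objective Q (complement I))"
      and goals: "goal P \<noteq> goal Q"
      using PQ I by auto
    obtain vs where vs: "distinct vs" "set vs = verts (graph I)" and w: "w = instnc_code I vs"
      using PQ I by (auto simp: instnc_codes_def)
    let ?V = "vertices I vs" and ?w = "instnc_code (complement I) vs"
    define B' where "B' = (if strict \<and> blocked I then - 1 else B)"
    have code: "?w \<in> codes Q (complement I)"
      using PQ vs by (auto simp: instnc_codes_def)
    have w': "w = instance_bits (bound I) ?V"
      by (simp add: w instnc_code_eq)
    obtain n s where s: "exec c (init_regs [x]) n s" "s 0 = f [x]" "n \<le> poly p (length x)"
      using c by blast
    obtain t where t: "exec (rename_regs shift_reg c) (init_regs [x]) n t" "t 0 = s 0"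
      "\<And>r. r \<in> {INP..NEG} \<Longrightarrow> t r = init_regs [x] r"
      by (rule runs_shifted[OF s(1), of "init_regs [x]"]) (auto simp: init_regs_def)
    have t0: "t 0 = decision_code B (instance_bits (bound I) ?V)"
      using t(2) s(2) x w' by simp
    have empty: "\<forall>r \<in> {INP..NEG}. t r = []"
      using t(3) by (auto simp: init_regs_def)
    have B': "B' = (if strict \<and> has_infeasible (bound I) ?V then - 1 else B)"
      unfolding B'_def blocked_def has_infeasible_vertices[OF graph vs] ..
    obtain u where red: "runs (reduce_prog strict) t (2000 * (length (t 0) + 1) ^ 3) u"
      and u: "u 0 = decision_code (int (budget I) - B') ?w"
      using runs_reduce_prog[OF t0 empty well_formed_vertices refl B']
      by (auto simp: complement_bits_vertices[OF graph vs] free_total_vertices[OF graph vs])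
    have "length (t 0) \<le> length x + poly p (length x)"
      using exec_length[OF t(1), of 0] s(3) by (simp add: init_regs_def)
    then have red': "runs (reduce_prog strict) t (2000 * (length x + poly p (length x) + 1) ^ 3) u"
      by (intro runs_mono[OF red] mult_le_mono power_mono) auto
    have "runs d (init_regs [x]) (poly q (length x)) u"
      unfolding d_def poly_q by (intro runs_Seq[OF runs_exec[OF t(1) s(3)] red'])
    moreover have "reaches Q (complement I) (int (budget I) - B') \<longleftrightarrow> x \<in> L"
    proof (cases "strict \<and> blocked I")
      case True
      then have "goal Q = Maximize" "objective P I = {}"
        using PQ mir by auto
      then have "\<not> reaches P I B"
        by (simp add: reaches_def)
      moreover have "\<not> reaches Q (complement I) (int (budget I) + 1)"
        using le \<open>goal Q = Maximize\<close> by (fastforce simp: reaches_def)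
      ultimately show ?thesis
        using True reach by (simp add: B'_def)
    next
      case False
      with mir have "mirrored (budget I) (objective P I) (objective Q (complement I))"
        by auto
      from reaches_mirrored[OF this goals, of B] show ?thesis
        using False reach by (auto simp: B'_def)
    qed
    ultimately show ?thesis
      using u J code by (cases "x \<in> L") auto
  qed
  show "many_one_reducible L (?Y Q) (?N Q)"
    unfolding many_one_reducible_def
  proof (intro exI conjI allI)
    show "polytime_on {[x] | x. True} (\<lambda>xs. result d (init_regs xs) 0)"
    proof (rule polytime_on_result[where p = q])
      fix xs :: "bool list list"
      assume "xs \<in> {[x] | x. True}"
      then obtain x where xs: "xs = [x]"
        by blast
      obtain s where "runs d (init_regs [x]) (poly q (length x)) s"
        using d by blast
      then show "\<exists>s. runs d (init_regs xs) (poly q (sum_list (map length xs))) s"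
        using xs by auto
    qed
    fix x
    obtain s where s: "runs d (init_regs [x]) (poly q (length x)) s"
      "s 0 \<in> (if x \<in> L then ?Y Q else ?N Q)"
      using d by blast
    have "s 0 \<in> ?Y Q" if "x \<in> L"
      using s(2) that by (simp only: if_True)
    moreover have "s 0 \<in> ?N Q" if "x \<notin> L"
      using s(2) that by (simp only: if_False)
    ultimately show "x \<in> L \<longrightarrow> result d (init_regs [x]) 0 \<in> ?Y Q"
      "x \<notin> L \<longrightarrow> result d (init_regs [x]) 0 \<in> ?N Q"
      unfolding result_eq[OF s(1)] by blast+
  qed
qed

section \<open>Labelled domination and packing as complementary problems\<close>

lemma packing_function_zero: "packing_function I (\<lambda>v \<in> verts (graph I). 0)"
proof -
  have "sum (\<lambda>v \<in> verts (graph I). 0 :: nat) (closed_nbhd (graph I) v) = 0" if "v \<in> verts (graph I)" for v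
    using closed_nbhd_subset[OF that] by (intro sum.neutral) auto
  then show ?thesis
    by (auto simp: packing_function_def labelled_function_def)
qed

text \<open>The restrictions concern only bound and labels, while \<open>complement\<close> changes
  only demands; closure of \<open>R\<close> under \<open>complement\<close> captures all three pairs
  at once. Having the relation in both orders turns the one-way transfers into equivalences.\<close>

lemma complementary_LDF_LPF:
  fixes \<G> :: "'a graph set"
  assumes "\<forall>G\<in>\<G>. simple_graph G" and R: "\<And>I. R I \<Longrightarrow> R (complement I)"
  shows "complementary True (restrict_instances (LDF \<G>) R) (restrict_instances (LPF \<G>) R)"
    and "complementary False (restrict_instances (LPF \<G>) R) (restrict_instances (LDF \<G>) R)"
proof -
  have simps: "instances (restrict_instances P R) = {i \<in> instances P. R i}"
    "codes (restrict_instances P R) = codes P" "objective (restrict_instances P R) = objective P"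
    "goal (restrict_instances P R) = goal P" for P :: "'a instnc problem"
    by (simp_all add: restrict_instances_def)
  have basics: "instances (LDF \<G>) = {I. graph I \<in> \<G>}" "instances (LPF \<G>) = {I. graph I \<in> \<G>}"
    "codes (LDF \<G>) = instnc_codes" "codes (LPF \<G>) = instnc_codes"
    "goal (LDF \<G>) = Minimize" "goal (LPF \<G>) = Maximize"
    "objective (LDF \<G>) I = {sum f (verts (graph I)) | f. dominating_function I f}"
    "objective (LPF \<G>) I = {sum f (verts (graph I)) | f. packing_function I f}" for I :: "'a instnc"
    by (simp_all add: LDF_def LPF_def)
  have labelled: "labelled_function I f" if "dominating_function J f \<or> packing_function J f"
    "J = I \<or> J = complement I" for I J :: "'a instnc" and f
    using that by (auto simp: dominating_function_def packing_function_def)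
  have pack: "mirrored (budget I) (objective (LPF \<G>) I) (objective (LDF \<G>) (complement I))"
    if "simple_graph (graph I)" for I
    unfolding basics complement_simps
    by (rule mirrored_objectives)
      (use that in \<open>blast intro: labelled packing_flip_dominating dominating_flip_packing\<close>)+
  have dom: "mirrored (budget I) (objective (LDF \<G>) I) (objective (LPF \<G>) (complement I))"
    if "simple_graph (graph I)" "\<not> blocked I" for I
  proof -
    have "\<forall>v \<in> verts (graph I). demand I v \<le> room I v"
      using that(2) by (auto simp: blocked_def not_less)
    then show ?thesis
      unfolding basics complement_simps
      by (intro mirrored_objectives)
        (use that(1) in \<open>blast intro: labelled packing_flip_dominating' dominating_flip_packing'\<close>)+
  qed
  have infeasible: "objective (LDF \<G>) I = {}" if "simple_graph (graph I)" "blocked I" for I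
    using demand_le_room[OF that(1)] that(2) leD unfolding basics blocked_def by blast
  have pack_ne: "objective (LPF \<G>) I \<noteq> {}" for I
    unfolding basics using packing_function_zero[of I] by blast
  have pack_le: "objective (LPF \<G>) (complement I) \<subseteq> {..budget I}" if "simple_graph (graph I)" for I
  proof
    fix m
    assume "m \<in> objective (LPF \<G>) (complement I)"
    then obtain f where f: "packing_function (complement I) f" "m = sum f (verts (graph I))"
      unfolding basics complement_simps by blast
    show "m \<in> {..budget I}"
      using sum_flip_verts[OF that labelled, of "complement I" f] f by simp
  qed
  have dom_le: "objective (LDF \<G>) (complement I) \<subseteq> {..budget I}" if "simple_graph (graph I)" for I
    using mirrored_swap[OF pack[OF that]] by (simp add: mirrored_def)
  \<comment> \<open>The flip of the zero packing of \<open>I\<close> dominates in the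
    complement.\<close>
  have dom_ne: "objective (LDF \<G>) (complement I) \<noteq> {}" if "simple_graph (graph I)" for I
    using pack[OF that] pack_ne[of I] by (simp add: mirrored_def)
  show "complementary True (restrict_instances (LDF \<G>) R) (restrict_instances (LPF \<G>) R)"
    unfolding complementary_def simps basics(1-6)
    using assms dom pack_ne pack_le infeasible by simp
  show "complementary False (restrict_instances (LPF \<G>) R) (restrict_instances (LDF \<G>) R)"
    unfolding complementary_def simps basics(1-6)
    using assms pack dom_ne dom_le by simp
qed

lemma equivalent_LDF_LPF:
  fixes \<G> :: "'a graph set"
  assumes "\<forall>G\<in>\<G>. simple_graph G" "\<And>I. R I \<Longrightarrow> R (complement I)"
  shows "polytime_solvable (restrict_instances (LDF \<G>) R) \<longleftrightarrow>
      polytime_solvable (restrict_instances (LPF \<G>) R)"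
    and "NP_hard (restrict_instances (LDF \<G>) R) \<longleftrightarrow> NP_hard (restrict_instances (LPF \<G>) R)"
proof -
  have "complementary True (restrict_instances (LDF \<G>) R) (restrict_instances (LPF \<G>) R)"
    "complementary False (restrict_instances (LPF \<G>) R) (restrict_instances (LDF \<G>) R)"
    by (rule complementary_LDF_LPF; use assms in blast)+
  then show "polytime_solvable (restrict_instances (LDF \<G>) R) \<longleftrightarrow>
      polytime_solvable (restrict_instances (LPF \<G>) R)"
    "NP_hard (restrict_instances (LDF \<G>) R) \<longleftrightarrow> NP_hard (restrict_instances (LPF \<G>) R)"
    using polytime_solvable_complementary NP_hard_complementary by blast+
qed

theorem theorem2:
  fixes \<G> :: "'a graph set"
  assumes "\<forall>G\<in>\<G>. simple_graph G"
  shows "(polytime_solvable (LDF \<G>) \<longleftrightarrow> polytime_solvable (LPF \<G>)) \<and>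
         (NP_hard (LDF \<G>) \<longleftrightarrow> NP_hard (LPF \<G>)) \<and>
         (\<forall>l. (polytime_solvable (ell_LDF l \<G>) \<longleftrightarrow> polytime_solvable (ell_LPF l \<G>)) \<and>
              (NP_hard (ell_LDF l \<G>) \<longleftrightarrow> NP_hard (ell_LPF l \<G>))) \<and>
         (\<forall>l. (polytime_solvable (free_ell_LDF l \<G>) \<longleftrightarrow> polytime_solvable (free_ell_LPF l \<G>)) \<and>
              (NP_hard (free_ell_LDF l \<G>) \<longleftrightarrow> NP_hard (free_ell_LPF l \<G>)))"
proof -
  have all: "restrict_instances P (\<lambda>_. True) = P" for P :: "'a instnc problem"
    by (simp add: restrict_instances_def)
  have nested: "restrict_instances (restrict_instances P R) R' =
      restrict_instances P (\<lambda>I. R I \<and> R' I)" for P :: "'a instnc problem" and R R'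
    by (simp add: restrict_instances_def)
  note eq = equivalent_LDF_LPF[OF assms]
  have "polytime_solvable (LDF \<G>) \<longleftrightarrow> polytime_solvable (LPF \<G>)" "NP_hard (LDF \<G>) \<longleftrightarrow> NP_hard (LPF \<G>)"
    using eq[of "\<lambda>_. True"] by (simp_all add: all)
  moreover have "polytime_solvable (ell_LDF l \<G>) \<longleftrightarrow> polytime_solvable (ell_LPF l \<G>)"
    "NP_hard (ell_LDF l \<G>) \<longleftrightarrow> NP_hard (ell_LPF l \<G>)" for l
    unfolding ell_LDF_def ell_LPF_def by (rule eq; simp)+
  moreover have "polytime_solvable (free_ell_LDF l \<G>) \<longleftrightarrow> polytime_solvable (free_ell_LPF l \<G>)"
    "NP_hard (free_ell_LDF l \<G>) \<longleftrightarrow> NP_hard (free_ell_LPF l \<G>)" for l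
    unfolding free_ell_LDF_def free_ell_LPF_def ell_LDF_def ell_LPF_def nested
    by (rule eq; simp add: all_free_def)+
  ultimately show ?thesis
    by blast
qed

end
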